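(* Let $\alpha>1$, let $T>0$ and let $b\in L^1(\mathbb T)\setminus\{0\}$ be a non-negative function. There exists a positive constant $C_{b,T}>0$ such that for every $u_0\in L^2(\mathbb T)$, $$\Vert u_0\Vert^2_{L^2(\mathbb T)}\le C_{b,T}\int_0^T\int_{\mathbb T}b(x)\big\vert(e^{it\vert D_x\vert^{\alpha}}u_0)(x)\big\vert^2\,\mathrm dx\,\mathrm dt.$$
   Context: $\mathbb T=\mathbb R/2\pi\mathbb Z$. For $u_0\in L^2(\mathbb T)$ with Fourier coefficients $\widehat{u_0}(n)=\frac1{2\pi}\int_0^{2\pi}u_0(x)e^{-inx}\,\mathrm dx$ (ordinary Lebesgue measure in this formula), $n\in\mathbb Z$, and $t\in\mathbb R$, $$(e^{it\vert D_x\vert^{\alpha}}u_0)(x)=\sum_{n\in\mathbb Z}\widehat{u_0}(n)e^{it|n|^\alpha}e^{inx},$$ which is the solution of the fractional Schrödinger equation $i\partial_tu+|D_x|^\alpha u=0$ with $u|_{t=0}=u_0$, where $\widehat{|D_x|^\alpha f}(n)=|n|^\alpha\widehat f(n)$. *)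

theory Defs
  imports "HOL-Analysis.Analysis" "HOL-Library.Periodic_Fun"
begin

text \<open>Functions on \<open>\<real>/2\<pi>\<int>\<close> are represented by \<open>2\<pi>\<close>-periodic functions on the reals, and
  integration over \<open>\<real>/2\<pi>\<int>\<close> is Lebesgue integration over the fundamental domain \<open>[0, 2\<pi>)\<close>,
  without normalization.\<close>

abbreviation torus :: "real measure" where
  "torus \<equiv> lebesgue_on {0..<2 * pi}"

definition L1_torus :: "(real \<Rightarrow> real) set" where
  "L1_torus = {b. periodic_fun_simple b (2 * pi) \<and> integrable torus b}"

definition L2_torus :: "(real \<Rightarrow> complex) set" where
  "L2_torus = {u. periodic_fun_simple u (2 * pi) \<and> u \<in> borel_measurable torus
     \<and> integrable torus (\<lambda>x. (cmod (u x))\<^sup>2)}"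

definition L2_norm_torus :: "(real \<Rightarrow> complex) \<Rightarrow> real" where
  "L2_norm_torus u = sqrt (\<integral>x. (cmod (u x))\<^sup>2 \<partial>torus)"

definition fourier_coeff :: "(real \<Rightarrow> complex) \<Rightarrow> int \<Rightarrow> complex" where
  "fourier_coeff u n =
     complex_of_real (1 / (2 * pi)) * (\<integral>x. u x * exp (- (\<i> * of_int n * of_real x)) \<partial>torus)"

text \<open>\<open>v\<close> is the sum over all integers, in \<open>L\<^sup>2\<close>, of the functions \<open>f n\<close>; the
  convergence is unconditional, along the same filter as in \<^const>\<open>has_sum\<close>.\<close>

definition has_L2_sum :: "(int \<Rightarrow> real \<Rightarrow> complex) \<Rightarrow> (real \<Rightarrow> complex) \<Rightarrow> bool" where
  "has_L2_sum f v \<longleftrightarrow> v \<in> L2_torus \<and>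
     ((\<lambda>F. L2_norm_torus (\<lambda>x. v x - (\<Sum>n\<in>F. f n x))) \<longlongrightarrow> 0) (finite_subsets_at_top UNIV)"

text \<open>The sum of the Fourier series exists in \<open>L\<^sup>2\<close> for every \<open>u\<^sub>0\<close> in \<open>L\<^sup>2\<close>, but is unique only
  almost everywhere; at each time an arbitrary representative is chosen. Integrals over the torus
  at a fixed time do not depend on that choice. Note that \<open>0 powr \<alpha> = 0\<close>.\<close>

definition schrodinger_flow :: "real \<Rightarrow> real \<Rightarrow> (real \<Rightarrow> complex) \<Rightarrow> real \<Rightarrow> complex" where
  "schrodinger_flow \<alpha> t u0 = (SOME v. has_L2_sum
     (\<lambda>n x. fourier_coeff u0 n * exp (\<i> * of_real (t * \<bar>real_of_int n\<bar> powr \<alpha>))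
        * exp (\<i> * of_int n * of_real x)) v)"

end

theory Submission
  imports Defs
begin

text \<open>
The energy \<open>\<Sum> |c\<^sub>n|\<^sup>2\<close> of a solution \<open>\<Sum> c\<^sub>n e\<^sup>i\<^sup>t\<^sup>|\<^sup>n\<^sup>|\<^sup>\<alpha> e\<^sup>i\<^sup>n\<^sup>x\<close> is constant in time, and the time frequencies
\<open>k\<^sup>\<alpha>\<close> have gaps tending to infinity, because \<open>\<alpha> > 1\<close>. For such frequencies Ingham's inequality holds
on every interval of positive length \<open>T\<close>: the integral over \<open>[0, T]\<close> of \<open>|\<Sum> a\<^sub>k e\<^sup>i\<^sup>t\<^sup>\<omega>\<^sup>(\<^sup>k\<^sup>)|\<^sup>2\<close> is at least a
constant times \<open>\<Sum> |a\<^sub>k|\<^sup>2\<close>. The high frequencies are handled by almost orthogonality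
(\<open>ingham_large_gap\<close>), and the finitely many low ones, where the gaps may be too small for \<open>T\<close>, are
restored one at a time (\<open>observable_add_lowest_frequency\<close>, \<open>observable_if_gaps_at_top\<close>).

The inequality is scalar, and it is applied at each fixed point \<open>x\<close>, with \<open>a\<^sub>k\<close> the value at \<open>x\<close> of
\<open>c\<^sub>k e\<^sup>i\<^sup>k\<^sup>x + c\<^sub>-\<^sub>k e\<^sup>-\<^sup>i\<^sup>k\<^sup>x\<close>; these two modes have the same time frequency. After integration in \<open>x\<close>
against the weight, it remains to bound the weighted energy of each such pair from below by a multiple
of \<open>|c\<^sub>k|\<^sup>2 + |c\<^sub>-\<^sub>k|\<^sup>2\<close>. The weight, cut off at height \<open>1\<close>, has a Fourier integral of order \<open>2 k\<close> strictly
smaller in modulus than its integral, since it is not concentrated on the countable set where \<open>e\<^sup>2\<^sup>i\<^sup>k\<^sup>x\<close>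
has a given value, and the difference is bounded below uniformly in \<open>k\<close> by the Riemann-Lebesgue lemma
(\<open>weight_fourier_uniform_gap\<close>, \<open>weighted_pair_energy\<close>). So the theorem holds for trigonometric
polynomials with a uniform constant (\<open>schrodinger_trig_observability\<close>).

In the passage to the limit, the distance in \<open>L\<^sup>2\<close> between a solution and its partial sum does not depend on
time, so the error made in the double integral tends to zero. This uses that the flow exists
(\<open>riesz_fischer\<close>) and that the energy of the initial datum is the energy of its Fourier coefficients
(\<open>fourier_series_converges\<close>). The latter, completeness, is obtained from Stone-Weierstrass on the circle:
an integrable function orthogonal to all \<open>e\<^sup>i\<^sup>n\<^sup>x\<close> integrates to zero over intervals, hence over all measurable
sets.
\<close>

section \<open>Ingham inequalities for frequencies with growing gaps\<close>

lemma cmod_cis_minus_1_le: "cmod (cis x - 1) \<le> \<bar>x\<bar>"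
  using dist_exp_i_1 [of x] abs_sin_x_le_abs_x [of "x / 2"] by (simp add: cis_conv_exp)

text \<open>The parabola \<open>t (T - t)\<close> vanishes at both ends of the interval, so two integrations by parts
produce no term of order \<open>1 / s\<close>. The resulting decay \<open>1 / s\<^sup>2\<close> is summable over linearly separated
frequencies; the decay \<open>1 / s\<close> of the Fourier transform of the indicator of \<open>[0, T]\<close> is not.\<close>

lemma parabola_weight_fourier_bound:
  fixes s T :: real
  assumes s: "s \<noteq> 0" and T: "T \<ge> 0"
  obtains W where "((\<lambda>t. complex_of_real (t * (T - t)) * cis (s * t)) has_integral W) {0..T}"
    and "cmod W \<le> 4 * T / s\<^sup>2"
proof -
  define z where "z = \<i> * complex_of_real s"
  have z: "z \<noteq> 0" using s by (simp add: z_def)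
  \<comment> \<open>The antiderivative obtained by integrating by parts until the polynomial is exhausted.\<close>
  define F where "F w = w * (of_real T - w) * exp (z * w) / z
      - (of_real T - 2 * w) * exp (z * w) / z^2 - 2 * exp (z * w) / z^3" for w :: complex
  have F: "(F has_field_derivative w * (of_real T - w) * exp (z * w)) (at w)" for w
    unfolding F_def using z
    by (auto intro!: derivative_eq_intros simp: field_simps power2_eq_square power3_eq_cube)
  have cis: "cis (s * t) = exp (z * of_real t)" for t
    by (simp add: cis_conv_exp z_def mult.assoc)
  have I: "((\<lambda>t. complex_of_real (t * (T - t)) * cis (s * t)) has_integral
      (F (of_real T) - F (of_real 0))) {0..T}"
  proof (rule fundamental_theorem_of_calculus [OF T])
    fix t assume "t \<in> {0..T}"
    show "((\<lambda>x. F (complex_of_real x)) has_vector_derivative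
      complex_of_real (t * (T - t)) * cis (s * t)) (at t within {0..T})"
      using has_vector_derivative_real_field [OF F [of "of_real t"]] by (simp add: cis)
  qed
  have "F (of_real T) - F (of_real 0) = of_real T * (cis (s * T) + 1) / z^2 - 2 * (cis (s * T) - 1) / z^3"
    unfolding F_def cis using z by (simp add: field_simps power2_eq_square power3_eq_cube)
  also have "cmod \<dots> \<le> cmod (of_real T * (cis (s * T) + 1) / z^2) + cmod (2 * (cis (s * T) - 1) / z^3)"
    by (rule norm_triangle_ineq4)
  also have "cmod (of_real T * (cis (s * T) + 1) / z^2) \<le> 2 * T / s\<^sup>2"
  proof -
    have "cmod (cis (s * T) + 1) \<le> 2"
      using norm_triangle_ineq [of "cis (s * T)" 1] by simp
    then show ?thesis using T s
      by (simp add: norm_mult norm_divide norm_power z_def power_mult_distrib divide_right_mono mult.commute mult_left_mono)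
  qed
  also have "cmod (2 * (cis (s * T) - 1) / z^3) \<le> 2 * T / s\<^sup>2"
  proof -
    have "cmod (2 * (cis (s * T) - 1) / z^3) = 2 * cmod (cis (s * T) - 1) / \<bar>s\<bar>^3"
      unfolding norm_mult norm_divide norm_power by (simp add: z_def norm_mult)
    also have "\<dots> \<le> 2 * (\<bar>s\<bar> * T) / \<bar>s\<bar>^3"
      using cmod_cis_minus_1_le [of "s * T"] T by (intro divide_right_mono) (auto simp: abs_mult)
    also have "\<dots> = 2 * T / s\<^sup>2"
      using s by (simp add: power2_eq_square power3_eq_cube)
    finally show ?thesis .
  qed
  finally show ?thesis using that [OF I] by simp
qed

definition exp_sum :: "(nat \<Rightarrow> real) \<Rightarrow> (nat \<Rightarrow> complex) \<Rightarrow> nat \<Rightarrow> nat \<Rightarrow> real \<Rightarrow> complex" where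
  "exp_sum \<omega> a N M t = (\<Sum>k\<in>{N..<M}. a k * cis (\<omega> k * t))"

lemma continuous_on_exp_sum [continuous_intros]:
  "continuous_on S g \<Longrightarrow> continuous_on S (\<lambda>t. exp_sum \<omega> a N M (g t))"
  unfolding exp_sum_def by (intro continuous_intros)

text \<open>This is the bound on the row sums that Schur's test needs below.\<close>

lemma sum_inverse_squares_le:
  obtains S :: real where "S > 0" and "\<And>F (k::nat). finite F \<Longrightarrow> (\<Sum>j\<in>F - {k}. 1 / (real j - real k)\<^sup>2) \<le> S"
proof -
  define s where "s = (\<Sum>n. 1 / (real (Suc n))\<^sup>2)"
  have summ: "summable (\<lambda>n. 1 / (real (Suc n))\<^sup>2)"
    using summable_Suc_iff [of "\<lambda>n. 1 / (real n)\<^sup>2"] inverse_power_summable [of 2, where ?'a = real]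
    by (simp add: inverse_eq_divide)
  have part: "(\<Sum>n\<in>A. 1 / (real (Suc n))\<^sup>2) \<le> s" if "finite A" for A
    unfolding s_def by (intro sum_le_suminf summ that) auto
  have "(\<Sum>j\<in>F - {k}. 1 / (real j - real k)\<^sup>2) \<le> 2 * s" if "finite F" for F and k :: nat
  proof -
    have "F - {k} = {j\<in>F. j < k} \<union> {j\<in>F. k < j}" by auto
    then have "(\<Sum>j\<in>F - {k}. 1 / (real j - real k)\<^sup>2) =
        (\<Sum>j\<in>{j\<in>F. j < k}. 1 / (real j - real k)\<^sup>2) + (\<Sum>j\<in>{j\<in>F. k < j}. 1 / (real j - real k)\<^sup>2)"
      using that by (simp add: sum.union_disjoint disjoint_iff)
    also have "(\<Sum>j\<in>{j\<in>F. j < k}. 1 / (real j - real k)\<^sup>2) = (\<Sum>n\<in>(\<lambda>j. k - Suc j) ` {j\<in>F. j < k}. 1 / (real (Suc n))\<^sup>2)"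
      by (subst sum.reindex) (auto simp: inj_on_def of_nat_diff power2_commute intro!: sum.cong)
    also have "(\<Sum>j\<in>{j\<in>F. k < j}. 1 / (real j - real k)\<^sup>2) = (\<Sum>n\<in>(\<lambda>j. j - Suc k) ` {j\<in>F. k < j}. 1 / (real (Suc n))\<^sup>2)"
      by (subst sum.reindex) (auto simp: inj_on_def of_nat_diff intro!: sum.cong)
    finally show ?thesis
      using part [of "(\<lambda>j. k - Suc j) ` {j\<in>F. j < k}"] part [of "(\<lambda>j. j - Suc k) ` {j\<in>F. k < j}"] that
      by simp
  qed
  moreover have "s > 0"
    unfolding s_def by (rule suminf_pos [OF summ]) auto
  ultimately show ?thesis using that [of "2 * s"] by simp
qed

lemma cmod_exp_sum_sq:
  "complex_of_real ((cmod (exp_sum \<omega> a N M t))\<^sup>2) =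
     (\<Sum>j\<in>{N..<M}. \<Sum>k\<in>{N..<M}. a j * cnj (a k) * cis ((\<omega> j - \<omega> k) * t))"
  unfolding complex_norm_square exp_sum_def
  by (simp add: cis_cnj cis_mult sum_product algebra_simps)

text \<open>Ingham's argument: weighted by \<open>t (T - t) \<le> T\<^sup>2 / 4\<close>, the integral of the squared modulus is a
quadratic form in the coefficients. Its diagonal is \<open>T\<^sup>3 / 6\<close>, and by Schur's test the off-diagonal part
is at most \<open>4 T S / \<gamma>\<^sup>2\<close>, which the hypothesis on \<open>\<gamma> T\<close> makes no more than half of the diagonal. What
remains is \<open>T\<^sup>3 / 12\<close>, and dividing by \<open>T\<^sup>2 / 4\<close> gives the constant \<open>T / 3\<close>.\<close>

lemma ingham_large_gap:
  fixes \<omega> :: "nat \<Rightarrow> real"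
  assumes T: "T > 0"
    and S: "S > 0" "\<And>F (k::nat). finite F \<Longrightarrow> (\<Sum>j\<in>F - {k}. 1 / (real j - real k)\<^sup>2) \<le> S"
    and \<gamma>: "\<gamma> > 0" "48 * S \<le> (\<gamma> * T)\<^sup>2"
    and gap: "\<And>j k. N \<le> k \<Longrightarrow> N \<le> j \<Longrightarrow> \<bar>\<omega> j - \<omega> k\<bar> \<ge> \<gamma> * \<bar>real j - real k\<bar>"
  shows "T / 3 * (\<Sum>k\<in>{N..<M}. (cmod (a k))\<^sup>2) \<le> integral {0..T} (\<lambda>t. (cmod (exp_sum \<omega> a N M t))\<^sup>2)"
proof -
  define A where "A = (\<Sum>k\<in>{N..<M}. (cmod (a k))\<^sup>2)"
  define f where "f = exp_sum \<omega> a N M"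
  define p where "p t = t * (T - t)" for t :: real
  have p0: "0 \<le> p t" if "t \<in> {0..T}" for t using that by (simp add: p_def)
  have p1: "p t \<le> T\<^sup>2 / 4" for t
    using zero_le_power2 [of "t - T/2"] by (simp add: p_def power2_eq_square algebra_simps)
  define W where "W j k = integral {0..T} (\<lambda>t. complex_of_real (p t) * cis ((\<omega> j - \<omega> k) * t))" for j k
  have W: "((\<lambda>t. complex_of_real (p t) * cis ((\<omega> j - \<omega> k) * t)) has_integral W j k) {0..T}" for j k
    unfolding W_def p_def by (intro integrable_integral integrable_continuous_real continuous_intros)
  have W1: "cmod (W j k) \<le> 4 * T / \<gamma>\<^sup>2 * (1 / (real j - real k)\<^sup>2)"
    if "j \<in> {N..<M}" "k \<in> {N..<M}" "j \<noteq> k" for j k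
  proof -
    have g: "0 < \<gamma> * \<bar>real j - real k\<bar>" "\<gamma> * \<bar>real j - real k\<bar> \<le> \<bar>\<omega> j - \<omega> k\<bar>"
      using gap [of k j] \<gamma> that by auto
    then have "\<omega> j - \<omega> k \<noteq> 0" by auto
    then obtain V where "((\<lambda>t. complex_of_real (p t) * cis ((\<omega> j - \<omega> k) * t)) has_integral V) {0..T}"
        and V: "cmod V \<le> 4 * T / (\<omega> j - \<omega> k)\<^sup>2"
      using parabola_weight_fourier_bound [of "\<omega> j - \<omega> k" T] T unfolding p_def by auto
    then have "W j k = V" using W has_integral_unique by blast
    with V have "cmod (W j k) \<le> 4 * T / (\<omega> j - \<omega> k)\<^sup>2" by simp
    also have "(\<gamma> * \<bar>real j - real k\<bar>)\<^sup>2 \<le> (\<omega> j - \<omega> k)\<^sup>2"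
      using g power_mono [of "\<gamma> * \<bar>real j - real k\<bar>" "\<bar>\<omega> j - \<omega> k\<bar>" 2] by simp
    then have "4 * T / (\<omega> j - \<omega> k)\<^sup>2 \<le> 4 * T / (\<gamma> * \<bar>real j - real k\<bar>)\<^sup>2"
      using g T by (intro divide_left_mono mult_pos_pos) (auto simp: zero_less_power)
    finally show ?thesis by (simp add: power_mult_distrib)
  qed
  have W0: "W k k = of_real (T^3/6)" for k
  proof -
    have "((\<lambda>t. p t) has_integral (T * T^2/2 - T^3/3 - (T * 0^2/2 - 0^3/3))) {0..T}"
      unfolding p_def using T
      by (intro fundamental_theorem_of_calculus)
        (auto intro!: derivative_eq_intros simp: has_real_derivative_iff_has_vector_derivative [symmetric] algebra_simps power2_eq_square)
    then have "((\<lambda>t. complex_of_real (p t)) has_integral of_real (T * T^2/2 - T^3/3 - (T * 0^2/2 - 0^3/3))) {0..T}"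
      by (rule has_integral_linear [OF _ bounded_linear_of_real, unfolded o_def])
    then show ?thesis unfolding W_def by (simp add: integral_unique power2_eq_square power3_eq_cube)
  qed
  define I where "I = integral {0..T} (\<lambda>t. p t * (cmod (f t))\<^sup>2)"
  have "(\<lambda>t. p t * (cmod (f t))\<^sup>2) integrable_on {0..T}"
    unfolding p_def f_def by (intro integrable_continuous_real continuous_intros)
  then have "((\<lambda>t. p t * (cmod (f t))\<^sup>2) has_integral I) {0..T}"
    unfolding I_def by (rule integrable_integral)
  then have I1: "((\<lambda>t. complex_of_real (p t * (cmod (f t))\<^sup>2)) has_integral of_real I) {0..T}"
    by (rule has_integral_linear [OF _ bounded_linear_of_real, unfolded o_def])
  have "((\<lambda>t. \<Sum>j\<in>{N..<M}. \<Sum>k\<in>{N..<M}. a j * cnj (a k) * (complex_of_real (p t) * cis ((\<omega> j - \<omega> k) * t)))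
      has_integral (\<Sum>j\<in>{N..<M}. \<Sum>k\<in>{N..<M}. a j * cnj (a k) * W j k)) {0..T}"
    by (intro has_integral_sum has_integral_mult_right W) auto
  also have "(\<lambda>t. \<Sum>j\<in>{N..<M}. \<Sum>k\<in>{N..<M}. a j * cnj (a k) * (complex_of_real (p t) * cis ((\<omega> j - \<omega> k) * t)))
      = (\<lambda>t. complex_of_real (p t * (cmod (f t))\<^sup>2))"
    unfolding of_real_mult f_def cmod_exp_sum_sq sum_distrib_left by (simp add: mult_ac)
  finally have "of_real I = (\<Sum>j\<in>{N..<M}. \<Sum>k\<in>{N..<M}. a j * cnj (a k) * W j k)"
    using I1 has_integral_unique by blast
  also have "\<dots> = (\<Sum>j\<in>{N..<M}. of_real (T^3/6) * of_real ((cmod (a j))\<^sup>2) + (\<Sum>k\<in>{N..<M}-{j}. a j * cnj (a k) * W j k))"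
    by (intro sum.cong refl, subst sum.remove) (auto simp: W0 complex_norm_square simp del: of_real_power)
  also have "\<dots> = of_real (T^3/6 * A) + (\<Sum>j\<in>{N..<M}. \<Sum>k\<in>{N..<M}-{j}. a j * cnj (a k) * W j k)" (is "_ = _ + ?E")
    by (simp add: sum.distrib A_def sum_distrib_left)
  finally have IE: "of_real I = of_real (T^3/6 * A) + ?E" .
  define K where "K j k = 1 / (real j - real k)\<^sup>2" for j k :: nat
  have Ksym: "K j k = K k j" for j k by (simp add: K_def power2_commute)
  define D where "D = 4 * T / \<gamma>\<^sup>2"
  have D: "D \<ge> 0" using T by (simp add: D_def)
  have "cmod ?E \<le> (\<Sum>j\<in>{N..<M}. \<Sum>k\<in>{N..<M}-{j}. D / 2 * ((cmod (a j))\<^sup>2 * K j k + (cmod (a k))\<^sup>2 * K j k))"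
  proof (intro sum_norm_le)
    fix j k assume jk: "j \<in> {N..<M}" "k \<in> {N..<M}-{j}"
    have "cmod (a j * cnj (a k) * W j k) \<le> cmod (a j) * cmod (a k) * (D * K j k)"
      unfolding norm_mult complex_mod_cnj D_def K_def using jk by (intro mult_left_mono W1) auto
    also have "\<dots> = cmod (a j) * cmod (a k) * 2 * (D / 2 * K j k)" by simp
    also have "\<dots> \<le> ((cmod (a j))\<^sup>2 + (cmod (a k))\<^sup>2) * (D / 2 * K j k)"
      using sum_squares_bound [of "cmod (a j)" "cmod (a k)"] D by (intro mult_right_mono) (auto simp: K_def)
    finally show "cmod (a j * cnj (a k) * W j k) \<le> D / 2 * ((cmod (a j))\<^sup>2 * K j k + (cmod (a k))\<^sup>2 * K j k)"
      by (simp add: algebra_simps)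
  qed
  also have "\<dots> = D / 2 * ((\<Sum>j\<in>{N..<M}. (cmod (a j))\<^sup>2 * (\<Sum>k\<in>{N..<M}-{j}. K j k))
       + (\<Sum>j\<in>{N..<M}. \<Sum>k\<in>{N..<M}-{j}. (cmod (a k))\<^sup>2 * K j k))" (is "_ = D / 2 * (?R + _)")
    by (simp add: sum.distrib sum_distrib_left algebra_simps)
  also have "(\<Sum>j\<in>{N..<M}. \<Sum>k\<in>{N..<M}-{j}. (cmod (a k))\<^sup>2 * K j k) = ?R"
  proof -
    have d: "{N..<M}-{j} = {k\<in>{N..<M}. k \<noteq> j}" "{N..<M}-{j} = {k\<in>{N..<M}. j \<noteq> k}" for j by auto
    have "(\<Sum>j\<in>{N..<M}. \<Sum>k\<in>{N..<M}-{j}. (cmod (a k))\<^sup>2 * K j k)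
        = (\<Sum>k\<in>{N..<M}. \<Sum>j\<in>{N..<M}-{k}. (cmod (a k))\<^sup>2 * K j k)"
      by (subst d(1), subst d(2), rule sum.swap_restrict) auto
    then show ?thesis by (simp add: sum_distrib_left Ksym)
  qed
  also have "D / 2 * (?R + ?R) = D * ?R" by simp
  also have "\<dots> \<le> D * (\<Sum>j\<in>{N..<M}. (cmod (a j))\<^sup>2 * S)"
  proof (intro mult_left_mono sum_mono D zero_le_power2)
    show "(\<Sum>k\<in>{N..<M}-{j}. K j k) \<le> S" for j
      unfolding Ksym [of j] using S(2) [of "{N..<M}" j] by (simp add: K_def)
  qed
  also have "\<dots> = D * S * A" by (simp add: A_def sum_distrib_left sum_distrib_right mult_ac)
  finally have E: "cmod ?E \<le> D * S * A" .
  have "D * S \<le> T^3 / 12"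
  proof -
    have "4 * T * S * 12 \<le> T * (\<gamma> * T)\<^sup>2" using \<gamma>(2) T by simp
    then show ?thesis using \<gamma>(1) by (simp add: D_def field_simps power2_eq_square power3_eq_cube)
  qed
  moreover have A: "A \<ge> 0" by (simp add: A_def sum_nonneg)
  ultimately have "D * S * A \<le> T^3/12 * A" by (rule mult_right_mono)
  moreover have "cmod ?E = \<bar>I - T^3/6 * A\<bar>"
  proof -
    have "?E = of_real (I - T^3/6 * A)" using IE by simp
    then show ?thesis by (metis norm_of_real)
  qed
  ultimately have "T^3/12 * A \<le> I" using E by (simp add: abs_le_iff)
  also have "I \<le> integral {0..T} (\<lambda>t. T\<^sup>2 / 4 * (cmod (f t))\<^sup>2)"
    unfolding I_def
  proof (rule integral_le)
    show "(\<lambda>t. p t * (cmod (f t))\<^sup>2) integrable_on {0..T}"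
      unfolding p_def f_def by (intro integrable_continuous_real continuous_intros)
    show "(\<lambda>t. T\<^sup>2 / 4 * (cmod (f t))\<^sup>2) integrable_on {0..T}"
      unfolding f_def by (intro integrable_continuous_real continuous_intros) auto
  qed (intro mult_right_mono p1 zero_le_power2)
  also have "\<dots> = T\<^sup>2 / 4 * integral {0..T} (\<lambda>t. (cmod (f t))\<^sup>2)" by simp
  finally show ?thesis unfolding A_def f_def using T
    by (simp add: field_simps power2_eq_square power3_eq_cube)
qed


text \<open>Cauchy-Schwarz against the constant function, from the positivity of the variance of \<open>g\<close>.\<close>

lemma integral_power2_le:
  fixes g :: "real \<Rightarrow> real"
  assumes g: "continuous_on {0..T} g" and T: "T > 0"
  shows "(integral {0..T} g)\<^sup>2 \<le> T * integral {0..T} (\<lambda>t. (g t)\<^sup>2)"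
proof -
  define m where "m = integral {0..T} g / T"
  have i: "g integrable_on {0..T}" "(\<lambda>t. (g t)\<^sup>2) integrable_on {0..T}"
    by (intro integrable_continuous_real continuous_intros g)+
  have "0 \<le> integral {0..T} (\<lambda>t. (g t - m)\<^sup>2)"
    by (intro integral_nonneg integrable_continuous_real continuous_intros g) auto
  also have "((\<lambda>t. (g t)\<^sup>2 - 2 * m * g t + m\<^sup>2) has_integral
      (integral {0..T} (\<lambda>t. (g t)\<^sup>2) - 2 * m * integral {0..T} g + (T - 0) *\<^sub>R m\<^sup>2)) {0..T}"
    using T by (intro has_integral_add has_integral_diff has_integral_mult_right integrable_integral i has_integral_const_real [THEN has_integral_eq_rhs]) auto
  then have "integral {0..T} (\<lambda>t. (g t - m)\<^sup>2) =
      integral {0..T} (\<lambda>t. (g t)\<^sup>2) - 2 * m * integral {0..T} g + T * m\<^sup>2"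
    by (intro integral_unique) (simp add: power2_diff algebra_simps)
  finally show ?thesis using T by (simp add: m_def field_simps power2_eq_square)
qed

text \<open>Near \<open>r\<close> the function \<open>x - sin x\<close> is bounded below because it is positive and increasing; beyond \<open>2\<close>
it exceeds \<open>x / 2\<close>.\<close>

lemma sin_below_line:
  fixes r :: real
  assumes r: "r > 0"
  obtains c where "c > 0" and "\<And>x. x \<ge> r \<Longrightarrow> c * x \<le> x - sin x"
proof -
  have pos: "sin x < x" if "x > 0" for x :: real
  proof (cases "x \<le> 1")
    case True
    then have "sin (x/2) > 0" "cos (x/2) < cos 0"
      using that pi_gt3 True by (intro sin_gt_zero cos_monotone_0_pi; linarith)+
    then have "sin (x/2) * cos (x/2) < sin (x/2) * 1" by (intro mult_strict_left_mono) auto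
    then show ?thesis using sin_double [of "x/2"] sin_x_le_x [of "x/2"] that by simp
  next
    case False
    then show ?thesis using sin_le_one [of x] by linarith
  qed
  have mono: "r - sin r \<le> x - sin x" if "r \<le> x" for x
    by (rule DERIV_nonneg_imp_nondecreasing [OF that]) (auto intro!: exI derivative_eq_intros)
  \<comment> \<open>On \<open>[r, 2]\<close> the ratio to \<open>x \<le> 2\<close> costs a factor \<open>2\<close>.\<close>
  define c where "c = min (1/2) ((r - sin r) / 2)"
  have "c > 0" using pos [OF r] by (simp add: c_def)
  moreover have "c * x \<le> x - sin x" if x: "r \<le> x" for x
  proof (cases "x \<le> 2")
    case True
    have "c * x \<le> (r - sin r) / 2 * 2"
      using True r x pos [OF r] unfolding c_def by (intro mult_mono min.cobounded2) auto
    then show ?thesis using mono [OF x] by simp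
  next
    case False
    have "c * x \<le> 1 / 2 * x" using False by (intro mult_right_mono) (auto simp: c_def)
    then show ?thesis using False sin_le_one [of x] by linarith
  qed
  ultimately show ?thesis by (rule that)
qed

text \<open>The constant is uniform in the coefficients and in the number \<open>M\<close> of frequencies, but may depend on the
index \<open>N\<close> of the lowest one; this is the property that is propagated from large \<open>N\<close> down to \<open>0\<close>.\<close>

definition observable :: "(nat \<Rightarrow> real) \<Rightarrow> nat \<Rightarrow> real \<Rightarrow> bool" where
  "observable \<omega> N T \<longleftrightarrow> (\<exists>c>0. \<forall>a M.
     c * (\<Sum>k\<in>{N..<M}. (cmod (a k))\<^sup>2) \<le> integral {0..T} (\<lambda>t. (cmod (exp_sum \<omega> a N M t))\<^sup>2))"

lemma observable_mono:
  assumes "observable \<omega> N T" "T \<le> T'"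
  shows "observable \<omega> N T'"
proof -
  have "integral {0..T} (\<lambda>t. (cmod (exp_sum \<omega> a N M t))\<^sup>2) \<le> integral {0..T'} (\<lambda>t. (cmod (exp_sum \<omega> a N M t))\<^sup>2)" for a M
    using assms(2) by (intro integral_subset_le integrable_continuous_real continuous_intros) auto
  with assms(1) show ?thesis unfolding observable_def by (meson order_trans)
qed

text \<open>Haraux's device for adding a frequency at the cost of an arbitrarily short additional time. The
difference \<open>f (t + \<delta>) - e\<^sup>i\<^sup>\<omega>\<^sup>\<delta> f t\<close>, with \<open>\<omega>\<close> the lowest frequency, contains only the higher ones,
each multiplied by a factor whose squared modulus is \<open>2 - 2 cos (\<nu> \<delta>)\<close>, with \<open>\<nu>\<close> the distance to \<open>\<omega>\<close>.
For a single \<open>\<delta>\<close> this factor may vanish, but its average over \<open>0 \<le> \<delta> \<le> T - \<tau>\<close> is bounded below,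
uniformly in \<open>\<nu> \<ge> g\<close>. This controls the higher coefficients. The lowest one is then the mean of
\<open>e\<^sup>-\<^sup>i\<^sup>\<omega>\<^sup>t f t\<close>, up to errors \<open>O(1 / \<nu>)\<close> from the others, and the sum of \<open>1 / \<nu>\<^sup>2\<close> is finite.\<close>

lemma observable_add_lowest_frequency:
  assumes obs: "observable \<omega> (Suc N) \<tau>" and \<tau>: "0 < \<tau>" "\<tau> < T"
    and g: "g > 0" "\<And>k. k > N \<Longrightarrow> \<omega> k - \<omega> N \<ge> g * (real k - real N)"
  shows "observable \<omega> N T"
proof -
  obtain c where c: "c > 0" and ineq: "\<And>a M. c * (\<Sum>k\<in>{Suc N..<M}. (cmod (a k))\<^sup>2) \<le>
      integral {0..\<tau>} (\<lambda>t. (cmod (exp_sum \<omega> a (Suc N) M t))\<^sup>2)"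
    using obs unfolding observable_def by blast
  define h where "h = T - \<tau>"
  have h: "h > 0" "\<tau> + h = T" using \<tau> by (auto simp: h_def)
  define \<nu> where "\<nu> k = \<omega> k - \<omega> N" for k
  have \<nu>: "g * (real k - real N) \<le> \<nu> k" "g \<le> \<nu> k" "\<nu> k > 0" if "k > N" for k
  proof -
    show 1: "g * (real k - real N) \<le> \<nu> k" using g(2) [OF that] by (simp add: \<nu>_def)
    have "g * 1 \<le> g * (real k - real N)" using that g(1) by (intro mult_left_mono) auto
    then show "g \<le> \<nu> k" "\<nu> k > 0" using 1 g(1) by linarith+
  qed
  obtain d where d: "d > 0" and sin_gap: "\<And>x. x \<ge> g * h \<Longrightarrow> d * x \<le> x - sin x"
    using sin_below_line [of "g * h"] g h by auto
  obtain S :: real where S: "S > 0" "\<And>F (k::nat). finite F \<Longrightarrow> (\<Sum>j\<in>F - {k}. 1 / (real j - real k)\<^sup>2) \<le> S"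
    using sum_inverse_squares_le by metis
  define K1 where "K1 = 2 / (c * d)"
  define K where "K = (2 * T + 8 * S * K1 / g\<^sup>2) / T\<^sup>2 + K1"
  have K1: "K1 > 0" using c d by (simp add: K1_def)
  have T: "T > 0" using \<tau> by simp
  have K: "K > 0" unfolding K_def using K1 T S g by (intro add_nonneg_pos divide_nonneg_pos) auto
  have "(\<Sum>k\<in>{N..<M}. (cmod (a k))\<^sup>2) \<le> K * integral {0..T} (\<lambda>t. (cmod (exp_sum \<omega> a N M t))\<^sup>2)" for a M
  proof (cases "N < M")
    case False
    then show ?thesis by (simp add: exp_sum_def)
  next
    case True
    define f where "f = exp_sum \<omega> a N M"
    have contf: "continuous_on A f" for A unfolding f_def by (intro continuous_intros)
    define J where "J = integral {0..T} (\<lambda>t. (cmod (f t))\<^sup>2)"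
    define B where "B = (\<Sum>k\<in>{Suc N..<M}. (cmod (a k))\<^sup>2)"
    have split: "{N..<M} = insert N {Suc N..<M}" using True by auto
    have int: "(\<lambda>t. (cmod (f t))\<^sup>2) integrable_on {x..y}" for x y
      by (intro integrable_continuous_real continuous_intros contf)
    have J0: "J \<ge> 0" unfolding J_def by (intro integral_nonneg int) auto
    \<comment> \<open>The translate by \<open>\<delta> \<le> h\<close> of the interval \<open>[0, \<tau>]\<close> stays inside \<open>[0, T]\<close>.\<close>
    have diff: "c * (\<Sum>k\<in>{Suc N..<M}. (cmod (a k))\<^sup>2 * (2 - 2 * cos (\<nu> k * \<delta>))) \<le> 4 * J" if \<delta>: "\<delta> \<in> {0..h}" for \<delta>
    proof -
      define a' where "a' k = a k * (cis (\<omega> k * \<delta>) - cis (\<omega> N * \<delta>))" for k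
      have a': "(cmod (a' k))\<^sup>2 = (cmod (a k))\<^sup>2 * (2 - 2 * cos (\<nu> k * \<delta>))" for k
      proof -
        have "(cmod (cis x - cis y))\<^sup>2 = 2 - 2 * cos (x - y)" for x y
        proof -
          have "(cmod (cis x - cis y))\<^sup>2 = ((cos x)\<^sup>2 + (sin x)\<^sup>2) + ((cos y)\<^sup>2 + (sin y)\<^sup>2) - 2 * (cos x * cos y + sin x * sin y)"
            unfolding cmod_power2 by (simp add: power2_eq_square algebra_simps)
          then show ?thesis by (simp add: cos_diff)
        qed
        then show ?thesis by (simp add: a'_def norm_mult power_mult_distrib \<nu>_def left_diff_distrib)
      qed
      have eq: "exp_sum \<omega> a' (Suc N) M t = f (t + \<delta>) - cis (\<omega> N * \<delta>) * f t" for t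
      proof -
        have "f (t + \<delta>) - cis (\<omega> N * \<delta>) * f t = (\<Sum>k\<in>{N..<M}. a' k * cis (\<omega> k * t))"
          unfolding f_def exp_sum_def sum_distrib_left sum_subtractf [symmetric] a'_def
          by (intro sum.cong refl) (simp add: algebra_simps flip: cis_mult)
        also have "\<dots> = exp_sum \<omega> a' (Suc N) M t"
          unfolding split by (simp add: a'_def exp_sum_def)
        finally show ?thesis ..
      qed
      have "c * (\<Sum>k\<in>{Suc N..<M}. (cmod (a k))\<^sup>2 * (2 - 2 * cos (\<nu> k * \<delta>))) \<le>
          integral {0..\<tau>} (\<lambda>t. (cmod (f (t + \<delta>) - cis (\<omega> N * \<delta>) * f t))\<^sup>2)"
        using ineq [of a' M] by (simp add: a' eq)
      also have "\<dots> \<le> integral {0..\<tau>} (\<lambda>t. 2 * (cmod (f (t + \<delta>)))\<^sup>2 + 2 * (cmod (f t))\<^sup>2)"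
      proof (intro integral_le integrable_continuous_real continuous_intros
          continuous_on_compose2 [OF contf [of UNIV]] subset_UNIV)
        fix t
        have "cmod (f (t + \<delta>) - cis (\<omega> N * \<delta>) * f t) \<le> cmod (f (t + \<delta>)) + cmod (f t)"
          using norm_triangle_ineq4 [of "f (t + \<delta>)" "cis (\<omega> N * \<delta>) * f t"] by (simp add: norm_mult)
        then have "(cmod (f (t + \<delta>) - cis (\<omega> N * \<delta>) * f t))\<^sup>2 \<le> (cmod (f (t + \<delta>)) + cmod (f t))\<^sup>2"
          by (intro power_mono) auto
        also have "\<dots> \<le> 2 * (cmod (f (t + \<delta>)))\<^sup>2 + 2 * (cmod (f t))\<^sup>2"
          using sum_squares_bound [of "cmod (f (t + \<delta>))" "cmod (f t)"] by (simp add: power2_sum)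
        finally show "(cmod (f (t + \<delta>) - cis (\<omega> N * \<delta>) * f t))\<^sup>2 \<le> 2 * (cmod (f (t + \<delta>)))\<^sup>2 + 2 * (cmod (f t))\<^sup>2" .
      qed
      also have "\<dots> = 2 * integral {0..\<tau>} (\<lambda>t. (cmod (f (t + \<delta>)))\<^sup>2) + 2 * integral {0..\<tau>} (\<lambda>t. (cmod (f t))\<^sup>2)"
        by (subst Henstock_Kurzweil_Integration.integral_add)
          (auto intro!: integrable_continuous_real continuous_intros continuous_on_compose2 [OF contf [of UNIV]])
      also have "integral {0..\<tau>} (\<lambda>t. (cmod (f (t + \<delta>)))\<^sup>2) = integral {\<delta>..\<tau>+\<delta>} (\<lambda>t. (cmod (f t))\<^sup>2)"
        using integral_shift_real_ivl [of \<delta> \<delta> "\<tau> + \<delta>" "\<lambda>t. (cmod (f t))\<^sup>2"] by simp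
      also have "\<dots> \<le> J"
        unfolding J_def using \<delta> h by (intro integral_subset_le int) auto
      also have "integral {0..\<tau>} (\<lambda>t. (cmod (f t))\<^sup>2) \<le> J"
        unfolding J_def using \<tau> by (intro integral_subset_le int) auto
      finally show ?thesis by simp
    qed
    have B: "B \<le> K1 * J"
    proof -
      have "((\<lambda>\<delta>. (cmod (a k))\<^sup>2 * (2 - 2 * cos (\<nu> k * \<delta>))) has_integral
          (cmod (a k))\<^sup>2 * (2 * h - 2 * sin (\<nu> k * h) / \<nu> k)) {0..h}" if "k \<in> {Suc N..<M}" for k
      proof -
        have "((\<lambda>\<delta>. 2 - 2 * cos (\<nu> k * \<delta>)) has_integral
           (2 * h - 2 * sin (\<nu> k * h) / \<nu> k - (2 * 0 - 2 * sin (\<nu> k * 0) / \<nu> k))) {0..h}"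
          using h \<nu> [of k] that
          by (intro fundamental_theorem_of_calculus)
            (auto intro!: derivative_eq_intros simp: has_real_derivative_iff_has_vector_derivative [symmetric] field_simps)
        then show ?thesis by (intro has_integral_mult_right) simp
      qed
      note hk = this
      have hi: "((\<lambda>\<delta>. c * (\<Sum>k\<in>{Suc N..<M}. (cmod (a k))\<^sup>2 * (2 - 2 * cos (\<nu> k * \<delta>)))) has_integral
          c * (\<Sum>k\<in>{Suc N..<M}. (cmod (a k))\<^sup>2 * (2 * h - 2 * sin (\<nu> k * h) / \<nu> k))) {0..h}"
        by (rule has_integral_mult_right, rule has_integral_sum) (auto intro: hk)
      have "((\<lambda>\<delta>. 4 * J) has_integral (h - 0) *\<^sub>R (4 * J)) {0..h}"
        using has_integral_const_real [of "4 * J" 0 h] h by simp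
      from has_integral_le [OF hi this diff]
      have "c * (\<Sum>k\<in>{Suc N..<M}. (cmod (a k))\<^sup>2 * (2 * h - 2 * sin (\<nu> k * h) / \<nu> k)) \<le> h * (4 * J)" by simp
      moreover have "(\<Sum>k\<in>{Suc N..<M}. (cmod (a k))\<^sup>2 * (2 * d * h)) \<le>
         (\<Sum>k\<in>{Suc N..<M}. (cmod (a k))\<^sup>2 * (2 * h - 2 * sin (\<nu> k * h) / \<nu> k))"
      proof (intro sum_mono mult_left_mono zero_le_power2)
        fix k assume "k \<in> {Suc N..<M}"
        then have k: "g \<le> \<nu> k" "\<nu> k > 0" using \<nu> [of k] by auto
        then have "d * (\<nu> k * h) \<le> \<nu> k * h - sin (\<nu> k * h)"
          using h by (intro sin_gap mult_right_mono) auto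
        then show "2 * d * h \<le> 2 * h - 2 * sin (\<nu> k * h) / \<nu> k"
          using k by (simp add: field_simps)
      qed
      ultimately have "c * (B * (2 * d * h)) \<le> h * (4 * J)"
        using c unfolding B_def sum_distrib_right by (meson mult_left_mono order_trans less_imp_le)
      then have "c * d * B \<le> 2 * J" using h by (simp add: mult_ac)
      then show ?thesis using c d by (simp add: K1_def field_simps)
    qed
    \<comment> \<open>Multiplication by \<open>cis (- (\<omega> N * t))\<close> makes the lowest mode constant, so integration isolates \<open>a N\<close>.\<close>
    have aN: "(cmod (a N))\<^sup>2 \<le> (2 * T + 8 * S * K1 / g\<^sup>2) / T\<^sup>2 * J"
    proof -
      define e where "e k = (cis (\<nu> k * T) - 1) / (\<i> * \<nu> k)" for k
      have hk: "((\<lambda>t. a k * cis (\<nu> k * t)) has_integral a k * e k) {0..T}" if "k \<in> {Suc N..<M}" for k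
      proof -
        have D: "((\<lambda>w. exp (\<i> * \<nu> k * w) / (\<i> * \<nu> k)) has_field_derivative exp (\<i> * \<nu> k * w)) (at w)" for w
          using \<nu> [of k] that by (auto intro!: derivative_eq_intros)
        have "((\<lambda>t. exp (\<i> * \<nu> k * complex_of_real t)) has_integral
            (exp (\<i> * \<nu> k * of_real T) / (\<i> * \<nu> k) - exp (\<i> * \<nu> k * of_real 0) / (\<i> * \<nu> k))) {0..T}"
          using T by (intro fundamental_theorem_of_calculus has_vector_derivative_real_field D) auto
        then have "((\<lambda>t. cis (\<nu> k * t)) has_integral e k) {0..T}"
          by (simp add: e_def cis_conv_exp mult.assoc diff_divide_distrib)
        then show ?thesis by (rule has_integral_mult_right)
      qed
      have "((\<lambda>t. a N + (\<Sum>k\<in>{Suc N..<M}. a k * cis (\<nu> k * t))) has_integral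
          ((T - 0) *\<^sub>R a N + (\<Sum>k\<in>{Suc N..<M}. a k * e k))) {0..T}"
        using T has_integral_const_real [of "a N" 0 T] by (intro has_integral_add has_integral_sum hk) auto
      also have "(\<lambda>t. a N + (\<Sum>k\<in>{Suc N..<M}. a k * cis (\<nu> k * t))) = (\<lambda>t. f t * cis (- (\<omega> N * t)))"
        unfolding f_def exp_sum_def split
        by (simp add: fun_eq_iff \<nu>_def cis_mult sum_distrib_right distrib_right mult.assoc left_diff_distrib)
      finally have I: "((\<lambda>t. f t * cis (- (\<omega> N * t))) has_integral (T *\<^sub>R a N + (\<Sum>k\<in>{Suc N..<M}. a k * e k))) {0..T}"
        by simp
      have "cmod (T *\<^sub>R a N + (\<Sum>k\<in>{Suc N..<M}. a k * e k)) \<le> integral {0..T} (\<lambda>t. cmod (f t))"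
        unfolding integral_unique [OF I, symmetric]
        by (intro integral_norm_bound_integral has_integral_integrable [OF I] integrable_continuous_real continuous_intros contf)
          (auto simp: norm_mult)
      moreover have "T * cmod (a N) \<le> cmod (T *\<^sub>R a N + (\<Sum>k\<in>{Suc N..<M}. a k * e k)) + cmod (\<Sum>k\<in>{Suc N..<M}. a k * e k)"
        using norm_triangle_ineq4 [of "T *\<^sub>R a N + (\<Sum>k\<in>{Suc N..<M}. a k * e k)" "\<Sum>k\<in>{Suc N..<M}. a k * e k"] T by simp
      moreover have "cmod (\<Sum>k\<in>{Suc N..<M}. a k * e k) \<le> (\<Sum>k\<in>{Suc N..<M}. cmod (a k) * (2 / \<nu> k))" (is "_ \<le> ?X")
      proof (rule sum_norm_le)
        fix k assume "k \<in> {Suc N..<M}"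
        moreover have "cmod (cis (\<nu> k * T) - 1) \<le> 2"
          using norm_triangle_ineq4 [of "cis (\<nu> k * T)" 1] by simp
        ultimately show "cmod (a k * e k) \<le> cmod (a k) * (2 / \<nu> k)"
          using \<nu> [of k] by (auto simp: e_def norm_mult norm_divide intro!: mult_left_mono divide_right_mono)
      qed
      ultimately have "T * cmod (a N) \<le> integral {0..T} (\<lambda>t. cmod (f t)) + ?X" by linarith
      then have "(T * cmod (a N))\<^sup>2 \<le> (integral {0..T} (\<lambda>t. cmod (f t)) + ?X)\<^sup>2"
        using T by (intro power_mono) auto
      also have "\<dots> \<le> 2 * (integral {0..T} (\<lambda>t. cmod (f t)))\<^sup>2 + 2 * ?X\<^sup>2"
        using sum_squares_bound [of "integral {0..T} (\<lambda>t. cmod (f t))" ?X] by (simp add: power2_sum)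
      also have "(integral {0..T} (\<lambda>t. cmod (f t)))\<^sup>2 \<le> T * J"
        unfolding J_def by (intro integral_power2_le continuous_intros contf T)
      also have "?X\<^sup>2 \<le> B * (\<Sum>k\<in>{Suc N..<M}. (2 / \<nu> k)\<^sup>2)"
        unfolding B_def by (rule Cauchy_Schwarz_ineq_sum)
      also have "\<dots> \<le> B * (4 / g\<^sup>2 * S)"
      proof (rule mult_left_mono)
        have "(\<Sum>k\<in>{Suc N..<M}. (2 / \<nu> k)\<^sup>2) \<le> (\<Sum>k\<in>{Suc N..<M}. 4 / g\<^sup>2 * (1 / (real k - real N)\<^sup>2))"
        proof (rule sum_mono)
          fix k assume "k \<in> {Suc N..<M}"
          then have k: "N < k" by simp
          have "2 / \<nu> k \<le> 2 / (g * (real k - real N))"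
            using \<nu> [OF k] k g by (intro divide_left_mono) auto
          then have "(2 / \<nu> k)\<^sup>2 \<le> (2 / (g * (real k - real N)))\<^sup>2"
            using \<nu> [OF k] by (intro power_mono) auto
          then show "(2 / \<nu> k)\<^sup>2 \<le> 4 / g\<^sup>2 * (1 / (real k - real N)\<^sup>2)"
            by (simp add: power_divide power_mult_distrib)
        qed
        also have "\<dots> = 4 / g\<^sup>2 * (\<Sum>k\<in>{N..<M} - {N}. 1 / (real k - real N)\<^sup>2)"
          unfolding sum_distrib_left by (rule sum.cong) auto
        also have "\<dots> \<le> 4 / g\<^sup>2 * S"
          by (intro mult_left_mono S) auto
        finally show "(\<Sum>k\<in>{Suc N..<M}. (2 / \<nu> k)\<^sup>2) \<le> 4 / g\<^sup>2 * S" .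
      qed (simp add: B_def sum_nonneg)
      also have "\<dots> \<le> K1 * J * (4 / g\<^sup>2 * S)"
        using B S g by (intro mult_right_mono) auto
      finally have "T\<^sup>2 * (cmod (a N))\<^sup>2 \<le> (2 * T + 8 * S * K1 / g\<^sup>2) * J"
        by (simp add: power_mult_distrib algebra_simps)
      then show ?thesis using T by (simp add: field_simps)
    qed
    have "(\<Sum>k\<in>{N..<M}. (cmod (a k))\<^sup>2) = (cmod (a N))\<^sup>2 + B"
      unfolding split B_def by simp
    also have "\<dots> \<le> K * J"
      using aN B by (simp add: K_def algebra_simps)
    finally show ?thesis unfolding J_def f_def .
  qed
  then show ?thesis using K
    unfolding observable_def by (intro exI [of _ "1 / K"]) (auto simp: field_simps)
qed

text \<open>Half of the time is spent on the high frequencies, whose gaps are as large as that half requires; the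
finitely many remaining frequencies are added one at a time, each consuming part of the time still
left over.\<close>

theorem observable_if_gaps_at_top:
  fixes \<omega> :: "nat \<Rightarrow> real"
  assumes pos: "\<And>k. \<omega> k < \<omega> (Suc k)"
    and gaps: "filterlim (\<lambda>k. \<omega> (Suc k) - \<omega> k) at_top sequentially" and T: "T > 0"
  shows "observable \<omega> 0 T"
proof -
  have linear: "\<gamma> * (real j - real k) \<le> \<omega> j - \<omega> k"
    if "\<And>i. k \<le> i \<Longrightarrow> \<gamma> \<le> \<omega> (Suc i) - \<omega> i" "k \<le> j" for \<gamma> j k
    using that(2)
  proof (induction j rule: dec_induct)
    case (step n)
    then show ?case using that(1) [of n] by (simp add: algebra_simps)
  qed auto
  obtain S :: real where S: "S > 0" "\<And>F (k::nat). finite F \<Longrightarrow> (\<Sum>j\<in>F - {k}. 1 / (real j - real k)\<^sup>2) \<le> S"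
    using sum_inverse_squares_le by metis
  define \<tau> where "\<tau> = T / 2"
  have \<tau>: "\<tau> > 0" "\<tau> < T" using T by (auto simp: \<tau>_def)
  \<comment> \<open>The smallest gap that the high-frequency estimate admits in time \<open>\<tau>\<close>.\<close>
  define \<gamma> where "\<gamma> = sqrt (48 * S) / \<tau>"
  have \<gamma>: "\<gamma> > 0" "48 * S \<le> (\<gamma> * \<tau>)\<^sup>2" using S \<tau> by (auto simp: \<gamma>_def)
  obtain N where N: "\<And>k. k \<ge> N \<Longrightarrow> \<gamma> \<le> \<omega> (Suc k) - \<omega> k"
    using gaps unfolding filterlim_at_top eventually_sequentially by blast
  have "observable \<omega> N \<tau>"
    unfolding observable_def
  proof (intro exI [of _ "\<tau> / 3"] conjI allI)
    have "\<gamma> * \<bar>real j - real k\<bar> \<le> \<bar>\<omega> j - \<omega> k\<bar>" if "N \<le> k" "N \<le> j" for j k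
      using linear [of k \<gamma> j] linear [of j \<gamma> k] that N by (cases "k \<le> j") auto
    then show "\<tau> / 3 * (\<Sum>k\<in>{N..<M}. (cmod (a k))\<^sup>2) \<le> integral {0..\<tau>} (\<lambda>t. (cmod (exp_sum \<omega> a N M t))\<^sup>2)" for a M
      by (intro ingham_large_gap [OF \<tau>(1) S \<gamma>])
  qed (use \<tau> in auto)
  then have base: "\<forall>t>\<tau>. observable \<omega> N t" using observable_mono by (meson less_imp_le)
  define g where "g = Min (insert \<gamma> ((\<lambda>k. \<omega> (Suc k) - \<omega> k) ` {..<N}))"
  have g: "g > 0" unfolding g_def using \<gamma> pos by (subst Min_gr_iff) auto
  have "g \<le> \<omega> (Suc k) - \<omega> k" for k
  proof (cases "k < N")
    case True
    then show ?thesis unfolding g_def by (intro Min_le) auto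
  next
    case False
    have "g \<le> \<gamma>" unfolding g_def by (intro Min_le) auto
    then show ?thesis using N [of k] False by simp
  qed
  then have g': "\<omega> k - \<omega> n \<ge> g * (real k - real n)" if "k > n" for k n
    using linear [of n g k] that by simp
  have "\<forall>t>\<tau>. observable \<omega> (N - n) t" for n
  proof (induction n)
    case 0
    then show ?case using base by simp
  next
    case (Suc n)
    show ?case
    proof (cases "n < N")
      case False
      then show ?thesis using Suc by simp
    next
      case True
      show ?thesis
      proof (intro allI impI)
        fix t assume t: "\<tau> < t"
        have "observable \<omega> (Suc (N - Suc n)) ((\<tau> + t) / 2)"
          using Suc t True by (simp add: Suc_diff_Suc)
        then show "observable \<omega> (N - Suc n) t"
          by (rule observable_add_lowest_frequency [OF _ _ _ g g']) (use t \<tau> in auto)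
      qed
    qed
  qed
  from this [of N] show ?thesis using \<tau> by simp
qed

section \<open>Pythagoras and Bessel for Fourier series\<close>

definition wave :: "int \<Rightarrow> real \<Rightarrow> complex" where
  "wave n x = exp (\<i> * of_int n * of_real x)"

definition trig_sum :: "(int \<Rightarrow> complex) \<Rightarrow> int set \<Rightarrow> real \<Rightarrow> complex" where
  "trig_sum c F x = (\<Sum>n\<in>F. c n * wave n x)"

text \<open>The \<open>L\<^sup>2\<close> condition on the fundamental domain alone, so that periodicity need not be carried through
the algebra of differences and limits.\<close>

definition square_integrable :: "(real \<Rightarrow> complex) \<Rightarrow> bool" where
  "square_integrable u \<longleftrightarrow> u \<in> borel_measurable torus \<and> integrable torus (\<lambda>x. (cmod (u x))\<^sup>2)"

text \<open>This is the squared \<open>L\<^sup>2\<close> norm; the identities below are polynomial in it.\<close>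

definition energy :: "(real \<Rightarrow> complex) \<Rightarrow> real" where
  "energy u = (\<integral>x. (cmod (u x))\<^sup>2 \<partial>torus)"

lemma wave_eq_cis: "wave n x = cis (of_int n * x)"
  by (simp add: wave_def cis_conv_exp mult.assoc)

lemma cmod_wave [simp]: "cmod (wave n x) = 1"
  by (simp add: wave_eq_cis)

lemma wave_mult: "wave n x * wave m x = wave (n + m) x"
  by (simp add: wave_eq_cis cis_mult algebra_simps)

lemma cnj_wave: "cnj (wave n x) = wave (- n) x"
  by (simp add: wave_eq_cis cis_cnj)

lemma wave_periodic: "wave n (x + 2 * pi) = wave n x"
proof -
  have "wave n (x + 2 * pi) = cis (of_int n * x) * cis (2 * pi * of_int n)"
    by (simp add: wave_eq_cis cis_mult algebra_simps)
  also have "cis (2 * pi * of_int n) = 1"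
    by (rule cis_multiple_2pi) auto
  finally show ?thesis by (simp add: wave_eq_cis)
qed

lemma finite_measure_torus: "finite_measure torus"
  by (intro finite_measure_lebesgue_on bounded_set_imp_lmeasurable) auto

lemma measure_space_torus: "measure torus {0..<2 * pi} = 2 * pi"
  by (subst measure_restrict_space) auto

lemma continuous_imp_measurable_torus:
  fixes f :: "real \<Rightarrow> 'a::euclidean_space"
  assumes "continuous_on UNIV f" shows "f \<in> borel_measurable torus"
  using assms by (intro continuous_imp_measurable_on_sets_lebesgue continuous_on_subset [OF assms]) auto

lemma wave_continuous [continuous_intros]: "continuous_on S (wave n)"
  unfolding wave_def by (intro continuous_intros)

lemma wave_measurable [measurable]: "wave n \<in> borel_measurable torus"
  by (intro continuous_imp_measurable_torus continuous_intros)

lemma trig_sum_measurable [measurable]: "trig_sum c F \<in> borel_measurable torus"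
  unfolding trig_sum_def by measurable

lemma integrable_torus_bounded:
  fixes f :: "real \<Rightarrow> 'a::{banach, second_countable_topology}"
  assumes "f \<in> borel_measurable torus" "\<And>x. norm (f x) \<le> B"
  shows "integrable torus f"
  by (rule finite_measure.integrable_const_bound [OF finite_measure_torus, of _ B]) (use assms in auto)

lemma integral_wave: "(\<integral>x. wave n x \<partial>torus) = (if n = 0 then 2 * pi else 0)"
proof (cases "n = 0")
  case True
  then show ?thesis by (simp add: wave_def measure_space_torus scaleR_conv_of_real)
next
  case False
  have D: "((\<lambda>w. exp (\<i> * of_int n * w) / (\<i> * of_int n)) has_field_derivative exp (\<i> * of_int n * w)) (at w)" for w
    using False by (auto intro!: derivative_eq_intros)
  have per: "exp (\<i> * of_int n * complex_of_real (2 * pi)) = 1"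
    using wave_periodic [of n 0] by (simp add: wave_def)
  have "(wave n has_integral
      (exp (\<i> * of_int n * complex_of_real (2 * pi)) / (\<i> * of_int n)
       - exp (\<i> * of_int n * complex_of_real 0) / (\<i> * of_int n))) {0..2 * pi}"
    unfolding wave_def by (intro fundamental_theorem_of_calculus has_vector_derivative_real_field D) auto
  then have 0: "(wave n has_integral 0) {0..2 * pi}"
    unfolding per by simp
  have "(wave n has_integral 0) {0..<2 * pi} \<longleftrightarrow> (wave n has_integral 0) {0..2 * pi}"
    by (rule has_integral_spike_set_eq) (auto intro: negligible_subset [of "{2 * pi}"])
  with 0 have "(wave n has_integral 0) {0..<2 * pi}" by simp
  moreover have "integrable torus (wave n)"
    by (rule integrable_torus_bounded [where B = 1]) auto
  ultimately show ?thesis using False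
    by (simp add: lebesgue_integral_eq_integral integral_unique)
qed

lemma square_integrable_bounded:
  assumes "u \<in> borel_measurable torus" "\<And>x. cmod (u x) \<le> B"
  shows "square_integrable u"
  unfolding square_integrable_def
proof (intro conjI integrable_torus_bounded [of _ "B\<^sup>2"])
  show "norm ((cmod (u x))\<^sup>2) \<le> B\<^sup>2" for x
    using power_mono [OF assms(2) norm_ge_zero, of x 2] by simp
qed (use assms(1) in auto)

lemma square_integrable_wave: "square_integrable (wave n)"
  by (rule square_integrable_bounded [of _ 1]) auto

lemma square_integrable_mult_integrable:
  assumes "square_integrable u" "square_integrable v"
  shows "integrable torus (\<lambda>x. u x * v x)"
proof (rule Bochner_Integration.integrable_bound)
  show "integrable torus (\<lambda>x. (cmod (u x))\<^sup>2 + (cmod (v x))\<^sup>2)"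
    using assms by (auto simp: square_integrable_def)
  show "(\<lambda>x. u x * v x) \<in> borel_measurable torus"
    using assms by (auto simp: square_integrable_def)
  have "cmod (u x * v x) \<le> (cmod (u x))\<^sup>2 + (cmod (v x))\<^sup>2" for x
    using sum_squares_bound [of "cmod (u x)" "cmod (v x)"] mult_nonneg_nonneg [of "cmod (u x)" "cmod (v x)"]
    unfolding norm_mult by (simp del: mult_nonneg_nonneg)
  then show "AE x in torus. cmod (u x * v x) \<le> norm ((cmod (u x))\<^sup>2 + (cmod (v x))\<^sup>2)"
    by simp
qed

lemma square_integrable_cnj: "square_integrable u \<Longrightarrow> square_integrable (\<lambda>x. cnj (u x))"
  unfolding square_integrable_def
  by (auto intro: borel_measurable_continuous_on [of cnj] continuous_on_cnj)

lemma square_integrable_cmult: "square_integrable u \<Longrightarrow> square_integrable (\<lambda>x. a * u x)"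
  by (auto simp: square_integrable_def norm_mult power_mult_distrib)

lemma square_integrable_add:
  assumes "square_integrable u" "square_integrable v"
  shows "square_integrable (\<lambda>x. u x + v x)"
  unfolding square_integrable_def
proof
  show "(\<lambda>x. u x + v x) \<in> borel_measurable torus"
    using assms by (auto simp: square_integrable_def)
  show "integrable torus (\<lambda>x. (cmod (u x + v x))\<^sup>2)"
  proof (rule Bochner_Integration.integrable_bound)
    show "integrable torus (\<lambda>x. 2 * (cmod (u x))\<^sup>2 + 2 * (cmod (v x))\<^sup>2)"
      using assms by (auto simp: square_integrable_def)
    show "(\<lambda>x. (cmod (u x + v x))\<^sup>2) \<in> borel_measurable torus"
      using assms by (auto simp: square_integrable_def)
    have "(cmod (u x + v x))\<^sup>2 \<le> 2 * (cmod (u x))\<^sup>2 + 2 * (cmod (v x))\<^sup>2" for x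
    proof -
      have "(cmod (u x + v x))\<^sup>2 \<le> (cmod (u x) + cmod (v x))\<^sup>2"
        by (intro power_mono norm_triangle_ineq) auto
      then show ?thesis using sum_squares_bound [of "cmod (u x)" "cmod (v x)"] by (simp add: power2_sum)
    qed
    then show "AE x in torus. norm ((cmod (u x + v x))\<^sup>2) \<le> norm (2 * (cmod (u x))\<^sup>2 + 2 * (cmod (v x))\<^sup>2)"
      by simp
  qed
qed

lemma square_integrable_diff:
  assumes "square_integrable u" "square_integrable v"
  shows "square_integrable (\<lambda>x. u x - v x)"
  using square_integrable_add [OF assms(1) square_integrable_cmult [OF assms(2), of "-1"]] by simp

lemma square_integrable_trig_sum: "square_integrable (trig_sum c F)"
proof (rule square_integrable_bounded [of _ "\<Sum>n\<in>F. cmod (c n)"])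
  show "cmod (trig_sum c F x) \<le> (\<Sum>n\<in>F. cmod (c n))" for x
    unfolding trig_sum_def by (rule sum_norm_le) (simp add: norm_mult)
qed measurable

lemma energy_nonneg: "energy u \<ge> 0"
  by (simp add: energy_def)

lemma integral_mult_cnj_wave: "(\<integral>x. u x * cnj (wave n x) \<partial>torus) = 2 * pi * fourier_coeff u n"
  by (simp add: fourier_coeff_def cnj_wave) (simp add: wave_def)

lemma energy_trig_sum:
  assumes "finite F" shows "energy (trig_sum c F) = 2 * pi * (\<Sum>n\<in>F. (cmod (c n))\<^sup>2)"
proof -
  have "of_real (energy (trig_sum c F)) = (\<integral>x. complex_of_real ((cmod (trig_sum c F x))\<^sup>2) \<partial>torus)"
    by (simp only: energy_def integral_complex_of_real)
  also have "\<dots> = (\<integral>x. (\<Sum>n\<in>F. \<Sum>m\<in>F. c n * cnj (c m) * wave (n - m) x) \<partial>torus)"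
    unfolding complex_norm_square trig_sum_def
    by (intro Bochner_Integration.integral_cong refl)
      (simp add: sum_product cnj_wave wave_mult [of _ _ "- m" for m, simplified, symmetric] mult_ac)
  also have "\<dots> = (\<Sum>n\<in>F. \<Sum>m\<in>F. c n * cnj (c m) * (\<integral>x. wave (n - m) x \<partial>torus))"
    by (simp add: Bochner_Integration.integral_sum integrable_torus_bounded [of _ 1])
  also have "\<dots> = (\<Sum>n\<in>F. c n * cnj (c n) * (2 * pi))"
    using assms by (simp add: integral_wave if_distrib sum.delta cong: if_cong)
  also have "\<dots> = of_real (2 * pi * (\<Sum>n\<in>F. (cmod (c n))\<^sup>2))"
    unfolding complex_norm_square [symmetric] by (simp add: sum_distrib_left mult_ac)
  finally show ?thesis by (simp only: of_real_eq_iff)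
qed

text \<open>Pythagoras in \<open>L\<^sup>2\<close>. For \<open>c\<close> equal to the Fourier coefficients it gives Bessel's inequality; for general
\<open>c\<close> it shows that a trigonometric sum close to \<open>u\<close> has coefficients close to those of \<open>u\<close>.\<close>

lemma energy_diff_trig_sum:
  assumes u: "square_integrable u" and F: "finite F"
  shows "energy (\<lambda>x. u x - trig_sum c F x) = energy u - 2 * pi * (\<Sum>n\<in>F. (cmod (fourier_coeff u n))\<^sup>2)
     + 2 * pi * (\<Sum>n\<in>F. (cmod (fourier_coeff u n - c n))\<^sup>2)"
proof -
  define I where "I = (\<integral>x. u x * cnj (trig_sum c F x) \<partial>torus)"
  have i: "integrable torus (\<lambda>x. u x * cnj (trig_sum c F x))"
    by (intro square_integrable_mult_integrable u square_integrable_cnj square_integrable_trig_sum)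
  have *: "(cmod (a - b))\<^sup>2 = (cmod a)\<^sup>2 - 2 * Re (a * cnj b) + (cmod b)\<^sup>2" for a b :: complex
    unfolding cmod_power2 by (simp add: power2_eq_square algebra_simps)
  have "energy (\<lambda>x. u x - trig_sum c F x) = energy u - 2 * Re I + energy (trig_sum c F)"
  proof -
    have "integrable torus (\<lambda>x. 2 * Re (u x * cnj (trig_sum c F x)))"
      by (intro integrable_mult_right integrable_Re i)
    then have "(\<integral>x. (cmod (u x))\<^sup>2 - 2 * Re (u x * cnj (trig_sum c F x)) + (cmod (trig_sum c F x))\<^sup>2 \<partial>torus)
        = energy u - (\<integral>x. 2 * Re (u x * cnj (trig_sum c F x)) \<partial>torus) + energy (trig_sum c F)"
      using u square_integrable_trig_sum [of c F] unfolding energy_def square_integrable_def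
      by (simp only: Bochner_Integration.integral_add Bochner_Integration.integral_diff Bochner_Integration.integrable_diff)
    also have "(\<integral>x. 2 * Re (u x * cnj (trig_sum c F x)) \<partial>torus) = 2 * Re I"
      unfolding I_def integral_mult_right_zero using integral_Re [OF i] by simp
    finally show ?thesis unfolding * [symmetric] by (simp only: energy_def)
  qed
  also have "I = (\<Sum>n\<in>F. cnj (c n) * (\<integral>x. u x * cnj (wave n x) \<partial>torus))"
  proof -
    have "I = (\<integral>x. (\<Sum>n\<in>F. cnj (c n) * (u x * cnj (wave n x))) \<partial>torus)"
      unfolding I_def trig_sum_def by (simp add: sum_distrib_left mult_ac)
    also have "\<dots> = (\<Sum>n\<in>F. \<integral>x. cnj (c n) * (u x * cnj (wave n x)) \<partial>torus)"
      by (intro Bochner_Integration.integral_sum integrable_mult_right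
        square_integrable_mult_integrable u square_integrable_cnj square_integrable_wave)
    finally show ?thesis by simp
  qed
  also have "\<dots> = 2 * pi * (\<Sum>n\<in>F. fourier_coeff u n * cnj (c n))"
    unfolding integral_mult_cnj_wave by (simp add: sum_distrib_left mult_ac)
  finally show ?thesis
    unfolding energy_trig_sum [OF F] *
    by (simp add: sum.distrib sum_subtractf sum_distrib_left algebra_simps)
qed

lemma bessel:
  assumes "square_integrable u" "finite F"
  shows "2 * pi * (\<Sum>n\<in>F. (cmod (fourier_coeff u n))\<^sup>2) \<le> energy u"
  using energy_diff_trig_sum [OF assms, of "fourier_coeff u"]
    energy_nonneg [of "\<lambda>x. u x - trig_sum (fourier_coeff u) F x"] by simp

lemma fourier_coeff_summable:
  assumes "square_integrable u"
  shows "(\<lambda>n. (cmod (fourier_coeff u n))\<^sup>2) summable_on UNIV"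
proof (rule nonneg_bdd_above_summable_on)
  show "bdd_above (sum (\<lambda>n. (cmod (fourier_coeff u n))\<^sup>2) ` {F. F \<subseteq> UNIV \<and> finite F})"
    using bessel [OF assms] by (intro bdd_aboveI [of _ "energy u / (2 * pi)"]) (auto simp: field_simps)
qed auto

lemma L2_torus_iff:
  "u \<in> L2_torus \<longleftrightarrow> periodic_fun_simple u (2 * pi) \<and> square_integrable u"
  by (simp add: L2_torus_def square_integrable_def)

lemma has_L2_sum_wave_iff:
  "has_L2_sum (\<lambda>n x. c n * exp (\<i> * of_int n * of_real x)) v \<longleftrightarrow> v \<in> L2_torus \<and>
     ((\<lambda>F. energy (\<lambda>x. v x - trig_sum c F x)) \<longlongrightarrow> 0) (finite_subsets_at_top UNIV)"
proof -
  have "((\<lambda>F. sqrt (f F)) \<longlongrightarrow> 0) A \<longleftrightarrow> (f \<longlongrightarrow> 0) A" if "\<And>F. f F \<ge> 0" for f :: "int set \<Rightarrow> real" and A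
  proof
    assume "((\<lambda>F. sqrt (f F)) \<longlongrightarrow> 0) A"
    then have "((\<lambda>F. (sqrt (f F))\<^sup>2) \<longlongrightarrow> 0\<^sup>2) A" by (rule tendsto_power)
    then show "(f \<longlongrightarrow> 0) A" using that by simp
  next
    assume "(f \<longlongrightarrow> 0) A"
    then show "((\<lambda>F. sqrt (f F)) \<longlongrightarrow> 0) A" using tendsto_real_sqrt by fastforce
  qed
  then show ?thesis
    unfolding has_L2_sum_def L2_norm_torus_def trig_sum_def wave_def energy_def by simp
qed

text \<open>The distance to a trigonometric sum dominates the error in each coefficient that the sum contains.\<close>

lemma energy_limit_imp_coeff:
  assumes v: "square_integrable v" and fin: "\<And>j::nat. finite (F j)" and ex: "\<And>n. eventually (\<lambda>j. n \<in> F j) sequentially"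
    and lim: "(\<lambda>j. energy (\<lambda>x. v x - trig_sum c (F j) x)) \<longlonglongrightarrow> 0"
  shows "fourier_coeff v n = c n"
proof -
  have "eventually (\<lambda>j. 2 * pi * (cmod (fourier_coeff v n - c n))\<^sup>2 \<le> energy (\<lambda>x. v x - trig_sum c (F j) x)) sequentially"
    using ex [of n]
  proof eventually_elim
    case (elim j)
    have "2 * pi * (cmod (fourier_coeff v n - c n))\<^sup>2 \<le> 2 * pi * (\<Sum>n\<in>F j. (cmod (fourier_coeff v n - c n))\<^sup>2)"
      using elim fin by (intro mult_left_mono member_le_sum) auto
    then show ?case
      using energy_diff_trig_sum [OF v fin, of c j] bessel [OF v fin, of j] by linarith
  qed
  from tendsto_lowerbound [OF lim this] have "2 * pi * (cmod (fourier_coeff v n - c n))\<^sup>2 \<le> 0" by simp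
  then show ?thesis using pi_gt_zero by (simp add: mult_le_0_iff)
qed

lemma eventually_mem_symmetric: "eventually (\<lambda>j. n \<in> {- int j..int j}) sequentially"
  unfolding eventually_sequentially by (intro exI [of _ "nat \<bar>n\<bar>"]) auto

lemma filterlim_symmetric:
  "filterlim (\<lambda>j. {- int j..int j}) (finite_subsets_at_top UNIV) sequentially"
proof (rule filterlim_finite_subsets_at_top [THEN iffD2], intro allI impI)
  fix X :: "int set" assume X: "finite X \<and> X \<subseteq> UNIV"
  have "eventually (\<lambda>j. \<forall>n\<in>X. n \<in> {- int j..int j}) sequentially"
    using X eventually_mem_symmetric by (intro eventually_ball_finite) auto
  then show "eventually (\<lambda>j. finite {- int j..int j} \<and> X \<subseteq> {- int j..int j} \<and> {- int j..int j} \<subseteq> UNIV) sequentially"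
    by eventually_elim auto
qed

text \<open>Pythagoras, passed to the limit. Since the distance to a partial sum depends only on the
energy and on the moduli of the coefficients, it does not change in time along the flow.\<close>

lemma has_L2_sum_wave_energy:
  assumes "has_L2_sum (\<lambda>n x. c n * exp (\<i> * of_int n * of_real x)) v"
  shows "fourier_coeff v = c"
    and "finite F \<Longrightarrow> energy (\<lambda>x. v x - trig_sum c F x) = energy v - 2 * pi * (\<Sum>n\<in>F. (cmod (c n))\<^sup>2)"
    and "((\<lambda>n. (cmod (c n))\<^sup>2) has_sum (energy v / (2 * pi))) UNIV"
proof -
  have v: "square_integrable v" and lim: "((\<lambda>F. energy (\<lambda>x. v x - trig_sum c F x)) \<longlongrightarrow> 0) (finite_subsets_at_top UNIV)"
    using assms unfolding has_L2_sum_wave_iff L2_torus_iff by auto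
  show c: "fourier_coeff v = c"
    by (rule ext, rule energy_limit_imp_coeff [OF v _ eventually_mem_symmetric filterlim_compose [OF lim filterlim_symmetric]]) auto
  show *: "energy (\<lambda>x. v x - trig_sum c F x) = energy v - 2 * pi * (\<Sum>n\<in>F. (cmod (c n))\<^sup>2)" if "finite F" for F
    using energy_diff_trig_sum [OF v that, of c] by (simp add: c)
  have "((\<lambda>F. (energy v - energy (\<lambda>x. v x - trig_sum c F x)) / (2 * pi)) \<longlongrightarrow> (energy v - 0) / (2 * pi)) (finite_subsets_at_top UNIV)"
    by (intro tendsto_intros lim) auto
  moreover have "eventually (\<lambda>F. (energy v - energy (\<lambda>x. v x - trig_sum c F x)) / (2 * pi) = (\<Sum>n\<in>F. (cmod (c n))\<^sup>2)) (finite_subsets_at_top UNIV)"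
    by (rule eventually_finite_subsets_at_top_weakI) (simp add: *)
  ultimately show "((\<lambda>n. (cmod (c n))\<^sup>2) has_sum (energy v / (2 * pi))) UNIV"
    unfolding has_sum_def using Lim_transform_eventually by fastforce
qed

section \<open>Square-summable Fourier series converge\<close>

lemma integral_norm_le_energy:
  assumes f: "square_integrable f"
  shows "(\<integral>x. cmod (f x) \<partial>torus)\<^sup>2 \<le> 2 * pi * energy f"
proof -
  have i: "integrable torus (\<lambda>x. cmod (f x))"
    using square_integrable_mult_integrable [OF f square_integrable_wave [of 0]]
    by (simp add: wave_def)
  define m where "m = (\<integral>x. cmod (f x) \<partial>torus) / (2 * pi)"
  have c: "integrable torus (\<lambda>x. m\<^sup>2)" by (rule integrable_torus_bounded [of _ "m\<^sup>2"]) auto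
  have "0 \<le> (\<integral>x. (cmod (f x) - m)\<^sup>2 \<partial>torus)" by simp
  also have "\<dots> = (\<integral>x. (cmod (f x))\<^sup>2 - 2 * m * cmod (f x) + m\<^sup>2 \<partial>torus)"
    by (simp add: power2_diff algebra_simps)
  also have "\<dots> = energy f - 2 * m * (\<integral>x. cmod (f x) \<partial>torus) + 2 * pi * m\<^sup>2"
    using f i c by (simp add: energy_def square_integrable_def measure_space_torus)
  finally show ?thesis
    by (simp add: m_def field_simps power2_eq_square)
qed

text \<open>Along a sequence of symmetric partial sums with geometrically small tails, the successive differences
are summable in \<open>L\<^sup>1\<close>, hence the partial sums converge almost everywhere; by Fatou's lemma their limit
is also an \<open>L\<^sup>2\<close> limit. The unconditional convergence of the whole family then follows from Pythagoras.\<close>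

lemma riesz_fischer:
  assumes c: "(\<lambda>n. (cmod (c n))\<^sup>2) summable_on UNIV"
  shows "\<exists>v. has_L2_sum (\<lambda>n x. c n * exp (\<i> * of_int n * of_real x)) v"
proof -
  define s where "s = (\<Sum>\<^sub>\<infinity>n. (cmod (c n))\<^sup>2)"
  have lim: "(sum (\<lambda>n. (cmod (c n))\<^sup>2) \<longlongrightarrow> s) (finite_subsets_at_top UNIV)"
    unfolding s_def using has_sum_infsum [OF c] by (simp add: has_sum_def)
  have le_s: "(\<Sum>n\<in>F. (cmod (c n))\<^sup>2) \<le> s" if "finite F" for F
    unfolding s_def by (rule finite_sum_le_infsum [OF c that]) auto
  have "\<exists>m. \<forall>j\<ge>m. s - (\<Sum>n\<in>{- int j..int j}. (cmod (c n))\<^sup>2) \<le> (1/4) ^ i" for i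
  proof -
    have "(\<lambda>j. s - (\<Sum>n\<in>{- int j..int j}. (cmod (c n))\<^sup>2)) \<longlonglongrightarrow> s - s"
      by (intro tendsto_intros filterlim_compose [OF lim filterlim_symmetric])
    then have "eventually (\<lambda>j. s - (\<Sum>n\<in>{- int j..int j}. (cmod (c n))\<^sup>2) < (1/4) ^ i) sequentially"
      by (rule order_tendstoD) simp
    then show ?thesis unfolding eventually_sequentially by (meson less_imp_le)
  qed
  then obtain m where m: "\<And>i j. j \<ge> m i \<Longrightarrow> s - (\<Sum>n\<in>{- int j..int j}. (cmod (c n))\<^sup>2) \<le> (1/4) ^ i"
    by metis
  \<comment> \<open>The sum makes \<open>M\<close> monotone and at least \<open>m i\<close>; the summand \<open>i\<close> makes the frequency ranges exhaust
    the integers even when \<open>m\<close> is bounded.\<close>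
  define M where "M i = i + sum m {..i}" for i :: nat
  define F where "F i = {- int (M i)..int (M i)}" for i
  have fin: "finite (F i)" for i by (simp add: F_def)
  have mono: "F i \<subseteq> F j" if "i \<le> j" for i j
  proof -
    have "sum m {..i} \<le> sum m {..j}" using that by (intro sum_mono2) auto
    then have "M i \<le> M j" using that by (simp add: M_def)
    then show ?thesis by (auto simp: F_def)
  qed
  have tail: "s - (\<Sum>n\<in>F i. (cmod (c n))\<^sup>2) \<le> (1/4) ^ i" for i
    unfolding F_def
  proof (rule m)
    have "m i \<le> sum m {..i}" by (intro member_le_sum) auto
    then show "m i \<le> M i" by (simp add: M_def)
  qed
  have ev: "eventually (\<lambda>j. n \<in> F j) sequentially" for n
    using eventually_mem_symmetric [of n]
  proof eventually_elim
    case (elim j)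
    have "j \<le> M j" by (simp add: M_def)
    then show ?case using elim by (auto simp: F_def)
  qed
  define S where "S i = trig_sum c (F i)" for i
  have S_meas [measurable]: "S i \<in> borel_measurable torus" for i
    unfolding S_def by measurable
  have sq: "square_integrable (\<lambda>x. S j x - S i x)" for i j
    unfolding S_def by (intro square_integrable_diff square_integrable_trig_sum)
  have S_diff: "energy (\<lambda>x. S j x - S i x) \<le> 2 * pi * (1/4) ^ i" if "i \<le> j" for i j
  proof -
    have "S j x - S i x = trig_sum c (F j - F i) x" for x
      unfolding S_def trig_sum_def by (simp add: sum_diff [OF fin mono [OF that]])
    then have "energy (\<lambda>x. S j x - S i x) = 2 * pi * (\<Sum>n\<in>F j - F i. (cmod (c n))\<^sup>2)"
      using energy_trig_sum [of "F j - F i" c] fin by (simp add: energy_def)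
    also have "(\<Sum>n\<in>F j - F i. (cmod (c n))\<^sup>2) = (\<Sum>n\<in>F j. (cmod (c n))\<^sup>2) - (\<Sum>n\<in>F i. (cmod (c n))\<^sup>2)"
      by (rule sum_diff [OF fin mono [OF that]])
    also have "\<dots> \<le> (1/4) ^ i"
      using tail [of i] le_s [OF fin [of j]] by linarith
    finally show ?thesis by simp
  qed
  define d where "d i x = cmod (S (Suc i) x - S i x)" for i x
  have int_d: "integrable torus (d i)" for i
    using square_integrable_mult_integrable [OF sq square_integrable_wave [of 0], of "Suc i" i]
    by (simp add: wave_def d_def [abs_def])
  have d_le: "(\<integral>x. d i x \<partial>torus) \<le> 2 * pi * (1/2) ^ i" for i
  proof -
    have "(\<integral>x. d i x \<partial>torus)\<^sup>2 \<le> 2 * pi * energy (\<lambda>x. S (Suc i) x - S i x)"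
      unfolding d_def by (rule integral_norm_le_energy [OF sq])
    also have "\<dots> \<le> 2 * pi * (2 * pi * (1/4) ^ i)"
      by (intro mult_left_mono S_diff) auto
    also have "\<dots> = (2 * pi * (1/2) ^ i)\<^sup>2"
      by (simp add: power2_eq_square power_mult_distrib [symmetric])
    finally show ?thesis by (rule power2_le_imp_le) auto
  qed
  have "(\<integral>\<^sup>+x. (\<Sum>i. ennreal (d i x)) \<partial>torus) = (\<Sum>i. \<integral>\<^sup>+x. ennreal (d i x) \<partial>torus)"
    using int_d by (intro nn_integral_suminf) auto
  also have "\<dots> = (\<Sum>i. ennreal (\<integral>x. d i x \<partial>torus))"
    by (intro suminf_cong nn_integral_eq_integral int_d) (auto simp: d_def)
  also have "\<dots> \<le> (\<Sum>i. ennreal (2 * pi * (1/2) ^ i))"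
    by (intro suminf_le ennreal_leI d_le) auto
  also have "\<dots> = ennreal (\<Sum>i. 2 * pi * (1/2) ^ i)"
    by (intro suminf_ennreal2 summable_mult) auto
  also have "\<dots> < \<infinity>" by simp
  finally have "AE x in torus. (\<Sum>i. ennreal (d i x)) \<noteq> \<infinity>"
    using int_d by (intro nn_integral_PInf_AE borel_measurable_suminf) auto
  then have conv: "AE x in torus. (\<lambda>i. S i x) \<longlonglongrightarrow> lim (\<lambda>i. S i x)"
  proof eventually_elim
    case (elim x)
    then have "summable (\<lambda>i. d i x)"
      by (intro summable_suminf_not_top) (auto simp: d_def)
    then have "summable (\<lambda>i. S (Suc i) x - S i x)"
      unfolding d_def by (rule summable_norm_cancel)
    then have "convergent (\<lambda>n. \<Sum>i<n. S (Suc i) x - S i x)"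
      by (simp add: summable_iff_convergent)
    then have "convergent (\<lambda>n. S n x - S 0 x)"
      by (simp add: sum_lessThan_telescope [of "\<lambda>i. S i x"])
    from convergent_add [OF this convergent_const [of "S 0 x"]]
    have "convergent (\<lambda>n. S n x)" by simp
    then show ?case by (simp add: convergent_LIMSEQ_iff)
  qed
  define v where "v x = lim (\<lambda>i. S i x)" for x
  have v_meas [measurable]: "v \<in> borel_measurable torus"
    unfolding v_def [abs_def] by measurable
  have nn: "(\<integral>\<^sup>+x. ennreal ((cmod (v x - S i x))\<^sup>2) \<partial>torus) \<le> ennreal (2 * pi * (1/4) ^ i)" for i
  proof -
    have "(\<integral>\<^sup>+x. ennreal ((cmod (v x - S i x))\<^sup>2) \<partial>torus)
        = (\<integral>\<^sup>+x. liminf (\<lambda>j. ennreal ((cmod (S j x - S i x))\<^sup>2)) \<partial>torus)"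
    proof (rule nn_integral_cong_AE, use conv in eventually_elim)
      case (elim x)
      then have "(\<lambda>j. ennreal ((cmod (S j x - S i x))\<^sup>2)) \<longlonglongrightarrow> ennreal ((cmod (v x - S i x))\<^sup>2)"
        unfolding v_def by (intro tendsto_ennrealI tendsto_intros)
      then show ?case by (intro lim_imp_Liminf [symmetric]) auto
    qed
    also have "\<dots> \<le> liminf (\<lambda>j. \<integral>\<^sup>+x. ennreal ((cmod (S j x - S i x))\<^sup>2) \<partial>torus)"
      by (intro nn_integral_liminf) measurable
    also have "\<dots> \<le> limsup (\<lambda>j. \<integral>\<^sup>+x. ennreal ((cmod (S j x - S i x))\<^sup>2) \<partial>torus)"
      by (rule Liminf_le_Limsup) simp
    also have "\<dots> \<le> ennreal (2 * pi * (1/4) ^ i)"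
    proof (rule Limsup_bounded)
      show "eventually (\<lambda>j. (\<integral>\<^sup>+x. ennreal ((cmod (S j x - S i x))\<^sup>2) \<partial>torus) \<le> ennreal (2 * pi * (1/4) ^ i)) sequentially"
        using eventually_ge_at_top [of i]
      proof eventually_elim
        case (elim j)
        have "(\<integral>\<^sup>+x. ennreal ((cmod (S j x - S i x))\<^sup>2) \<partial>torus) = ennreal (energy (\<lambda>x. S j x - S i x))"
          unfolding energy_def using sq [of j i]
          by (intro nn_integral_eq_integral) (auto simp: square_integrable_def)
        then show ?case using S_diff [OF elim] by (simp add: ennreal_leI)
      qed
    qed
    finally show ?thesis .
  qed
  have vS: "square_integrable (\<lambda>x. v x - S i x)" for i
    unfolding square_integrable_def
  proof
    show "integrable torus (\<lambda>x. (cmod (v x - S i x))\<^sup>2)"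
      using le_less_trans [OF nn [of i]] by (intro integrableI_nonneg) auto
  qed measurable
  have vS_le: "energy (\<lambda>x. v x - S i x) \<le> 2 * pi * (1/4) ^ i" for i
  proof -
    have "(\<integral>\<^sup>+x. ennreal ((cmod (v x - S i x))\<^sup>2) \<partial>torus) = ennreal (energy (\<lambda>x. v x - S i x))"
      unfolding energy_def using vS [of i]
      by (intro nn_integral_eq_integral) (auto simp: square_integrable_def)
    then show ?thesis using nn [of i] by simp
  qed
  have lim0: "(\<lambda>i. energy (\<lambda>x. v x - trig_sum c (F i) x)) \<longlonglongrightarrow> 0"
  proof (rule tendsto_sandwich [OF _ _ tendsto_const])
    show "(\<lambda>i. 2 * pi * (1/4) ^ i) \<longlonglongrightarrow> (0::real)"
      by (intro tendsto_mult_right_zero LIMSEQ_power_zero) auto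
  qed (use vS_le energy_nonneg in \<open>auto simp: S_def\<close>)
  have v: "square_integrable v"
    using square_integrable_add [OF vS [of 0] square_integrable_trig_sum [of c "F 0"]] by (simp add: S_def)
  have "periodic_fun_simple v (2 * pi)"
    by unfold_locales (simp add: v_def S_def trig_sum_def wave_periodic)
  with v have vL2: "v \<in> L2_torus" by (simp add: L2_torus_iff)
  have coeff: "fourier_coeff v n = c n" for n
    by (rule energy_limit_imp_coeff [OF v fin ev lim0])
  have en: "energy (\<lambda>x. v x - trig_sum c A x) = energy v - 2 * pi * (\<Sum>n\<in>A. (cmod (c n))\<^sup>2)" if "finite A" for A
    using energy_diff_trig_sum [OF v that, of c] by (simp add: coeff)
  have "(\<lambda>i. 2 * pi * (\<Sum>n\<in>F i. (cmod (c n))\<^sup>2)) \<longlonglongrightarrow> 2 * pi * s"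
  proof (intro tendsto_intros)
    show "(\<lambda>i. \<Sum>n\<in>F i. (cmod (c n))\<^sup>2) \<longlonglongrightarrow> s"
    proof (rule tendsto_sandwich [OF _ _ _ tendsto_const])
      show "(\<lambda>i. s - (1/4) ^ i) \<longlonglongrightarrow> s"
        using tendsto_diff [OF tendsto_const LIMSEQ_power_zero, of "1/4" s] by simp
      show "\<forall>\<^sub>F i in sequentially. s - (1/4) ^ i \<le> (\<Sum>n\<in>F i. (cmod (c n))\<^sup>2)"
        using tail by (intro always_eventually allI) (simp add: algebra_simps)
    qed (use le_s fin in auto)
  qed
  then have "(\<lambda>i. energy v - 2 * pi * (\<Sum>n\<in>F i. (cmod (c n))\<^sup>2)) \<longlonglongrightarrow> energy v - 2 * pi * s"
    by (intro tendsto_diff tendsto_const)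
  moreover have "(\<lambda>i. energy v - 2 * pi * (\<Sum>n\<in>F i. (cmod (c n))\<^sup>2)) \<longlonglongrightarrow> 0"
    using lim0 by (simp add: en fin)
  ultimately have ev: "energy v = 2 * pi * s"
    using LIMSEQ_unique by fastforce
  have "((\<lambda>A. energy v - 2 * pi * (\<Sum>n\<in>A. (cmod (c n))\<^sup>2)) \<longlongrightarrow> energy v - 2 * pi * s) (finite_subsets_at_top UNIV)"
    by (intro tendsto_intros lim)
  moreover have "eventually (\<lambda>A. energy v - 2 * pi * (\<Sum>n\<in>A. (cmod (c n))\<^sup>2) = energy (\<lambda>x. v x - trig_sum c A x)) (finite_subsets_at_top UNIV)"
    by (rule eventually_finite_subsets_at_top_weakI) (simp add: en)
  ultimately have "((\<lambda>A. energy (\<lambda>x. v x - trig_sum c A x)) \<longlongrightarrow> 0) (finite_subsets_at_top UNIV)"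
    using Lim_transform_eventually ev by fastforce
  then show ?thesis
    using vL2 unfolding has_L2_sum_wave_iff by blast
qed

section \<open>Completeness of the trigonometric system\<close>

lemma integrable_mult_cis_continuous:
  fixes h :: "complex \<Rightarrow> real"
  assumes w: "integrable torus w" and h: "continuous_on (sphere 0 1) h"
  shows "integrable torus (\<lambda>x. w x * complex_of_real (h (cis x)))"
proof -
  have "compact (h ` sphere 0 1)"
    by (intro compact_continuous_image h) auto
  then obtain B where B: "\<And>z. z \<in> sphere 0 1 \<Longrightarrow> \<bar>h z\<bar> \<le> B"
    by (metis (no_types, lifting) bounded_iff compact_imp_bounded image_eqI real_norm_def)
  have B0: "0 \<le> B" using B [of 1] by simp
  have "continuous_on UNIV (\<lambda>x. h (cis x))"
    by (rule continuous_on_compose2 [OF h]) (auto intro: continuous_intros)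
  then have m: "(\<lambda>x. h (cis x)) \<in> borel_measurable torus"
    by (rule continuous_imp_measurable_torus)
  show ?thesis
  proof (rule Bochner_Integration.integrable_bound)
    show "integrable torus (\<lambda>x. B * cmod (w x))" using w by simp
    show "(\<lambda>x. w x * complex_of_real (h (cis x))) \<in> borel_measurable torus"
      using borel_measurable_integrable [OF w] m by measurable
    show "AE x in torus. norm (w x * complex_of_real (h (cis x))) \<le> norm (B * cmod (w x))"
      using B B0 by (auto simp: norm_mult abs_mult mult.commute [of "cmod (w _)"] intro!: mult_right_mono)
  qed
qed

text \<open>Multiplication by a linear combination of \<open>cos x\<close> and \<open>sin x\<close> only shifts the waves, so it preserves
orthogonality to all of them. The induction is over \<open>p\<close> with \<open>w\<close> arbitrary: for a product, the second factor is applied to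
\<open>w\<close> times the first one.\<close>

lemma orthogonal_to_waves_polynomial:
  assumes "real_polynomial_function p" and "integrable torus w"
    and "\<And>n. (\<integral>x. w x * wave n x \<partial>torus) = 0"
  shows "(\<integral>x. w x * complex_of_real (p (cis x)) * wave n x \<partial>torus) = 0"
  using assms
proof (induction p arbitrary: w n rule: real_polynomial_function.induct)
  case (linear h)
  define \<alpha> where "\<alpha> = (of_real (h 1) - \<i> * of_real (h \<i>)) / 2"
  define \<beta> where "\<beta> = (of_real (h 1) + \<i> * of_real (h \<i>)) / 2"
  have h: "complex_of_real (h (cis x)) = \<alpha> * wave 1 x + \<beta> * wave (-1) x" for x
  proof -
    have "cis x = cos x *\<^sub>R 1 + sin x *\<^sub>R \<i>" by (simp add: complex_eq_iff)
    then have "h (cis x) = cos x * h 1 + sin x * h \<i>"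
      using linear(1) by (simp add: bounded_linear.linear linear_add linear_scale)
    then show ?thesis
      by (simp add: \<alpha>_def \<beta>_def wave_eq_cis complex_eq_iff field_simps)
  qed
  have "integrable torus (\<lambda>x. w x * wave m x)" for m
  proof (rule Bochner_Integration.integrable_bound [OF linear(2)])
    show "(\<lambda>x. w x * wave m x) \<in> borel_measurable torus"
      using borel_measurable_integrable [OF linear(2)] by measurable
  qed (auto simp: norm_mult)
  moreover have "w x * complex_of_real (h (cis x)) * wave n x =
      \<alpha> * (w x * wave (n + 1) x) + \<beta> * (w x * wave (n + - 1) x)" for x
    unfolding h wave_mult [symmetric] by (simp add: algebra_simps)
  ultimately show ?case by (simp add: linear(3))
next
  case (const c)
  have "w x * complex_of_real c * wave n x = c * (w x * wave n x)" for x by simp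
  then show ?case by (simp only: integral_mult_right_zero const(2)) simp
next
  case (add f g)
  have c: "continuous_on (sphere 0 1) f" "continuous_on (sphere 0 1) g"
    using add.hyps continuous_real_polymonial_function continuous_at_imp_continuous_on by blast+
  have i: "integrable torus (\<lambda>x. w x * complex_of_real (h (cis x)) * wave n x)"
    if "continuous_on (sphere 0 1) h" for h
  proof (rule Bochner_Integration.integrable_bound [OF integrable_mult_cis_continuous [OF add.prems(1) that]])
    show "(\<lambda>x. w x * complex_of_real (h (cis x)) * wave n x) \<in> borel_measurable torus"
      using borel_measurable_integrable [OF integrable_mult_cis_continuous [OF add.prems(1) that]] by measurable
  qed (auto simp: norm_mult)
  show ?case
    using add.IH [OF add.prems] i [OF c(1)] i [OF c(2)] by (simp add: algebra_simps)
next
  case (mult f g)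
  have "continuous_on (sphere 0 1) f"
    using mult.hyps continuous_real_polymonial_function continuous_at_imp_continuous_on by blast
  then have "integrable torus (\<lambda>x. w x * complex_of_real (f (cis x)))"
    by (rule integrable_mult_cis_continuous [OF mult.prems(1)])
  from mult.IH(2) [OF this mult.IH(1) [OF mult.prems]] show ?case
    by (simp add: mult.assoc)
qed

lemma eq_0_if_norm_le_every_multiple:
  fixes X :: "'a::real_normed_vector"
  assumes bound: "\<And>e. e > 0 \<Longrightarrow> norm X \<le> e * W" and W: "W \<ge> (0::real)"
  shows "X = 0"
proof -
  have "norm X \<le> 0"
  proof (rule field_le_epsilon)
    fix e :: real assume e: "e > 0"
    have "norm X \<le> e / (W + 1) * W"
      using W e by (intro bound divide_pos_pos) simp_all
    also have "\<dots> \<le> e / (W + 1) * (W + 1)"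
      using W e by (intro mult_left_mono divide_nonneg_nonneg) simp_all
    also have "\<dots> = e" using W by simp
    finally show "norm X \<le> 0 + e" by simp
  qed
  then show "X = 0" by simp
qed

text \<open>Stone-Weierstrass on the unit circle.\<close>

lemma orthogonal_to_waves_continuous:
  fixes h :: "complex \<Rightarrow> real"
  assumes w: "integrable torus w" and orth: "\<And>n. (\<integral>x. w x * wave n x \<partial>torus) = 0"
    and h: "continuous_on (sphere 0 1) h"
  shows "(\<integral>x. w x * complex_of_real (h (cis x)) \<partial>torus) = 0"
proof -
  define W where "W = (\<integral>x. cmod (w x) \<partial>torus)"
  have bound: "cmod (\<integral>x. w x * complex_of_real (h (cis x)) \<partial>torus) \<le> e * W" if e: "e > 0" for e
  proof -
    obtain p where p: "real_polynomial_function p" "\<And>z. z \<in> sphere 0 1 \<Longrightarrow> \<bar>h z - p z\<bar> < e"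
      using Stone_Weierstrass_real_polynomial_function [OF compact_sphere h e] by blast
    have cp: "continuous_on (sphere 0 1) p"
      using p(1) continuous_real_polymonial_function continuous_at_imp_continuous_on by blast
    have ip: "integrable torus (\<lambda>x. w x * complex_of_real (p (cis x)))"
      and ih: "integrable torus (\<lambda>x. w x * complex_of_real (h (cis x)))"
      by (intro integrable_mult_cis_continuous w cp h)+
    have "(\<integral>x. w x * complex_of_real (p (cis x)) \<partial>torus) = 0"
      using orthogonal_to_waves_polynomial [OF p(1) w orth, of 0] by (simp add: wave_def)
    then have "(\<integral>x. w x * complex_of_real (h (cis x)) \<partial>torus)
        = (\<integral>x. w x * complex_of_real (h (cis x)) - w x * complex_of_real (p (cis x)) \<partial>torus)"
      by (simp only: Bochner_Integration.integral_diff [OF ih ip] diff_zero)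
    also have "cmod \<dots> \<le> (\<integral>x. cmod (w x * complex_of_real (h (cis x)) - w x * complex_of_real (p (cis x))) \<partial>torus)"
      by (rule integral_norm_bound)
    also have "\<dots> \<le> (\<integral>x. e * cmod (w x) \<partial>torus)"
    proof (rule integral_mono)
      show "cmod (w x * complex_of_real (h (cis x)) - w x * complex_of_real (p (cis x))) \<le> e * cmod (w x)" for x
      proof -
        have "w x * complex_of_real (h (cis x)) - w x * complex_of_real (p (cis x)) = of_real (h (cis x) - p (cis x)) * w x"
          by (simp add: algebra_simps)
        moreover have "\<bar>h (cis x) - p (cis x)\<bar> \<le> e"
          using p(2) [of "cis x"] by (simp add: less_imp_le)
        ultimately show ?thesis
          by (simp only: norm_mult norm_of_real mult_right_mono norm_ge_zero)
      qed
    qed (intro integrable_norm Bochner_Integration.integrable_diff ih ip integrable_mult_right w)+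
    finally show ?thesis by (simp add: W_def)
  qed
  have "W \<ge> 0" unfolding W_def by (rule Bochner_Integration.integral_nonneg) simp
  with bound show ?thesis by (rule eq_0_if_norm_le_every_multiple)
qed

text \<open>The interval is an arc centred at \<open>r = a / 2\<close>, cut out by \<open>cos (x - r) > cos r\<close>. Its indicator is
therefore a bounded pointwise limit of continuous functions of the point \<open>cis x\<close> of the circle.\<close>

lemma orthogonal_to_waves_interval:
  assumes w: "integrable torus w" and orth: "\<And>n. (\<integral>x. w x * wave n x \<partial>torus) = 0"
    and a: "0 \<le> a" "a \<le> 2 * pi"
  shows "(\<integral>x. w x * of_real (indicator {0<..<a} x) \<partial>torus) = 0"
proof -
  define r where "r = a / 2"
  define h where "h k z = min 1 (real k * max 0 (Re (z * cis (- r)) - cos r))" for k :: nat and z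
  have h: "h k (cis x) = min 1 (real k * max 0 (cos (x - r) - cos r))" for k x
    by (simp add: h_def cis_mult)
  have lim: "(\<lambda>k. h k (cis x)) \<longlonglongrightarrow> indicator {0<..<a} x" if x: "x \<in> {0..<2*pi}" for x
  proof (cases "x \<in> {0<..<a}")
    case True
    then have "cos r < cos \<bar>x - r\<bar>"
      using a by (intro cos_monotone_0_pi) (auto simp: r_def abs_if)
    then have d: "cos (x - r) - cos r > 0" by (simp add: abs_if cos_minus [of "x - r", symmetric] split: if_splits del: cos_minus)
    obtain K where K: "1 < real K * (cos (x - r) - cos r)"
      using reals_Archimedean3 [OF d] by blast
    have "eventually (\<lambda>k. h k (cis x) = 1) sequentially"
      using eventually_ge_at_top [of K]
    proof eventually_elim
      case (elim k)
      have "real K * (cos (x - r) - cos r) \<le> real k * (cos (x - r) - cos r)"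
        using elim d by (intro mult_right_mono) auto
      with K have "1 \<le> real k * (cos (x - r) - cos r)" by linarith
      then have "1 \<le> real k * max 0 (cos (x - r) - cos r)" using d by (simp add: max_def)
      then show ?case by (simp add: h)
    qed
    then show ?thesis using True by (simp add: tendsto_eventually)
  next
    case False
    have "cos (x - r) \<le> cos r"
    proof (cases "x = 0")
      case False
      then have xa: "x \<ge> a" using \<open>x \<notin> {0<..<a}\<close> x by auto
      show ?thesis
      proof (cases "x - r \<le> pi")
        case True
        then show ?thesis using xa a by (intro cos_monotone_0_pi_le) (auto simp: r_def)
      next
        case False
        have "cos (2 * pi - (x - r)) \<le> cos r"
          using False x xa a by (intro cos_monotone_0_pi_le) (auto simp: r_def)
        then show ?thesis by (simp add: cos_diff)
      qed
    qed simp
    then have "h k (cis x) = 0" for k by (simp add: h max_def)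
    then show ?thesis using False by simp
  qed
  have cont: "continuous_on (sphere 0 1) (h k)" for k
    unfolding h_def by (intro continuous_intros)
  have "(\<lambda>k. \<integral>x. w x * complex_of_real (h k (cis x)) \<partial>torus) \<longlonglongrightarrow>
      (\<integral>x. w x * of_real (indicator {0<..<a} x) \<partial>torus)"
  proof (rule integral_dominated_convergence)
    show "integrable torus (\<lambda>x. cmod (w x))" using w by simp
    show "(\<lambda>x. w x * of_real (indicator {0<..<a} x)) \<in> borel_measurable torus"
    proof -
      have "{0<..<a} \<in> sets torus" using a by (auto simp: sets_restrict_space_iff)
      then have "(\<lambda>x. indicator {0<..<a} x *\<^sub>R w x) \<in> borel_measurable torus"
        by (intro borel_measurable_integrable integrable_mult_indicator [OF _ w])
      then show ?thesis by (simp only: scaleR_conv_of_real mult.commute [of "w _"])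
    qed
    show "AE x in torus. (\<lambda>k. w x * complex_of_real (h k (cis x))) \<longlonglongrightarrow> w x * of_real (indicator {0<..<a} x)"
      by (rule AE_I2, intro tendsto_mult_left tendsto_of_real lim) simp
    show "AE x in torus. cmod (w x * complex_of_real (h k (cis x))) \<le> cmod (w x)" for k
    proof (rule AE_I2)
      fix x
      have "\<bar>h k (cis x)\<bar> \<le> 1" unfolding h by (intro abs_leI) (auto intro: order_trans [of _ 0])
      then show "cmod (w x * complex_of_real (h k (cis x))) \<le> cmod (w x)"
        by (simp only: norm_mult norm_of_real mult_left_le norm_ge_zero)
    qed
    show "(\<lambda>x. w x * complex_of_real (h k (cis x))) \<in> borel_measurable torus" for k
      by (rule borel_measurable_integrable [OF integrable_mult_cis_continuous [OF w cont]])
  qed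
  then show ?thesis
    unfolding orthogonal_to_waves_continuous [OF w orth cont] LIMSEQ_const_iff by (rule sym)
qed

lemma AE_torus_neq: "AE x in torus. x \<noteq> a"
proof -
  have "AE x in lborel. x \<noteq> a" using AE_lborel_singleton .
  then have "AE x in lebesgue. x \<noteq> a" by (rule AE_completion)
  then have "AE x in lebesgue. x \<in> {0..<2 * pi} \<longrightarrow> x \<noteq> a" by (rule AE_mp) simp
  then show ?thesis by (subst AE_restrict_space_iff) simp_all
qed

text \<open>The sets over which \<open>w\<close> integrates to zero form a Dynkin system that contains the half-lines, hence
contains all Borel sets; each Lebesgue set differs from a Borel set by a null set.\<close>

lemma orthogonal_to_waves_imp_zero:
  assumes w: "integrable torus w" and orth: "\<And>n. (\<integral>x. w x * wave n x \<partial>torus) = 0"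
  shows "AE x in torus. w x = 0"
proof (rule sigma_finite_measure.density_zero [OF _ w])
  show "sigma_finite_measure torus"
    using finite_measure_torus by (rule finite_measure.axioms)
next
  have borel_sets: "B \<inter> {0..<2 * pi} \<in> sets torus" if "B \<in> sets borel" for B
  proof -
    have "B \<inter> {0..<2 * pi} \<in> sets borel" using that by (intro sets.Int) auto
    then have "B \<inter> {0..<2 * pi} \<in> sets lebesgue" by simp
    then show ?thesis by (subst sets_restrict_space_iff) auto
  qed
  have si: "integrable torus (\<lambda>x. indicator B x *\<^sub>R w x)" if "B \<in> sets borel" for B
  proof -
    have "integrable torus (\<lambda>x. indicator (B \<inter> {0..<2 * pi}) x *\<^sub>R w x)"
      by (rule integrable_mult_indicator [OF borel_sets [OF that] w])
    also have "?this \<longleftrightarrow> ?thesis"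
      by (intro Bochner_Integration.integrable_cong) (auto simp: indicator_def)
    finally show ?thesis .
  qed
  have interval: "(\<integral>x. indicator {..<a} x *\<^sub>R w x \<partial>torus) = 0" for a :: real
  proof -
    define b where "b = max 0 (min a (2 * pi))"
    have "(\<integral>x. indicator {..<a} x *\<^sub>R w x \<partial>torus) = (\<integral>x. w x * of_real (indicator {0<..<b} x) \<partial>torus)"
    proof (rule integral_cong_AE)
      show "(\<lambda>x. indicator {..<a} x *\<^sub>R w x) \<in> borel_measurable torus"
        by (intro borel_measurable_integrable si) simp
      have "(\<lambda>x. indicator {0<..<b} x *\<^sub>R w x) \<in> borel_measurable torus"
        by (intro borel_measurable_integrable si) simp
      then show "(\<lambda>x. w x * of_real (indicator {0<..<b} x)) \<in> borel_measurable torus"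
        by (simp only: scaleR_conv_of_real mult.commute [of "w _"])
      show "AE x in torus. indicator {..<a} x *\<^sub>R w x = w x * of_real (indicator {0<..<b} x)"
        using AE_torus_neq [of 0] AE_space
        by eventually_elim (auto simp: indicator_def b_def)
    qed
    then show ?thesis
      using orthogonal_to_waves_interval [OF w orth, of b] by (simp add: b_def)
  qed
  have borel: "(\<integral>x. indicator B x *\<^sub>R w x \<partial>torus) = 0" if "B \<in> sets borel" for B
  proof -
    have gen: "sets borel = sigma_sets UNIV (range (lessThan :: real \<Rightarrow> real set))"
      unfolding borel_Iio by simp
    have int: "Int_stable (range (lessThan :: real \<Rightarrow> real set))"
    proof (clarsimp simp: Int_stable_def)
      fix a b :: real
      have "{..<a} \<inter> {..<b} = {..<min a b}" by auto
      then show "{..<a} \<inter> {..<b} \<in> range lessThan" by blast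
    qed
    have sub: "range (lessThan :: real \<Rightarrow> real set) \<subseteq> Pow UNIV" by simp
    have total: "(\<integral>x. w x \<partial>torus) = 0" using orth [of 0] by (simp add: wave_def)
    show ?thesis
      using int sub that [unfolded gen]
    proof (induction B rule: sigma_sets_induct_disjoint)
      case (basic A)
      then show ?case using interval by auto
    next
      case empty
      then show ?case by simp
    next
      case (compl A)
      then have A: "A \<in> sets borel" using gen by simp
      have "(\<lambda>x. indicator (UNIV - A) x *\<^sub>R w x) = (\<lambda>x. w x - indicator A x *\<^sub>R w x)"
        by (auto simp: indicator_def)
      then show ?case using w si [OF A] compl total by simp
    next
      case (union A)
      have A: "A i \<in> sets borel" for i using union(2) gen by auto
      have cut: "(\<integral>x\<in>B \<inter> {0..<2 * pi}. w x \<partial>torus) = (\<integral>x. indicator B x *\<^sub>R w x \<partial>torus)" for B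
        unfolding set_lebesgue_integral_def
        by (intro Bochner_Integration.integral_cong) (auto simp: indicator_def)
      have "(\<integral>x\<in>(\<Union>i. A i \<inter> {0..<2 * pi}). w x \<partial>torus) = (\<Sum>i. \<integral>x\<in>A i \<inter> {0..<2 * pi}. w x \<partial>torus)"
      proof (rule lebesgue_integral_countable_add)
        show "set_integrable torus (\<Union>i. A i \<inter> {0..<2 * pi}) w"
          unfolding set_integrable_def using A
          by (intro integrable_mult_indicator w) (auto intro!: borel_sets)
        show "A i \<inter> {0..<2 * pi} \<inter> (A j \<inter> {0..<2 * pi}) = {}" if "i \<noteq> j" for i j
          using union(1) that by (auto simp: disjoint_family_on_def)
      qed (use A borel_sets in auto)
      also have "(\<Union>i. A i \<inter> {0..<2 * pi}) = (\<Union>i. A i) \<inter> {0..<2 * pi}" by auto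
      finally show ?case unfolding cut union(3) by simp
    qed
  qed
  fix A assume A: "A \<in> sets torus"
  then have "A \<in> sets lebesgue" by (subst (asm) sets_restrict_space_iff) auto
  then obtain S N N' where S: "A = S \<union> N" "N \<subseteq> N'" "N' \<in> null_sets lborel" "S \<in> sets lborel"
    by (rule sets_completionE)
  have "AE x in lebesgue. x \<notin> N'"
    by (rule AE_completion [OF AE_not_in [OF S(3)]])
  then have "AE x in lebesgue. x \<in> {0..<2 * pi} \<longrightarrow> x \<notin> N'" by (rule AE_mp) simp
  then have "AE x in torus. x \<notin> N'" by (subst AE_restrict_space_iff) simp_all
  then have "AE x in torus. indicator A x *\<^sub>R w x = indicator S x *\<^sub>R w x"
    by eventually_elim (use S in \<open>auto simp: indicator_def\<close>)
  then have "(\<integral>x. indicator A x *\<^sub>R w x \<partial>torus) = (\<integral>x. indicator S x *\<^sub>R w x \<partial>torus)"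
    using S(4) by (intro integral_cong_AE borel_measurable_integrable integrable_mult_indicator [OF A w] si) simp_all
  then show "set_lebesgue_integral torus A w = 0"
    unfolding set_lebesgue_integral_def using borel [of S] S(4) by (metis sets_lborel)
qed

text \<open>Completeness: the Riesz-Fischer sum of the Fourier series of \<open>u\<close> has the same coefficients as \<open>u\<close>, so
the difference is orthogonal to all waves and vanishes almost everywhere.\<close>

theorem fourier_series_converges:
  assumes u: "u \<in> L2_torus"
  shows "has_L2_sum (\<lambda>n x. fourier_coeff u n * exp (\<i> * of_int n * of_real x)) u"
proof -
  have sq: "square_integrable u" using u by (simp add: L2_torus_iff)
  obtain v where v: "has_L2_sum (\<lambda>n x. fourier_coeff u n * exp (\<i> * of_int n * of_real x)) v"
    using riesz_fischer [OF fourier_coeff_summable [OF sq]] by blast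
  have vsq: "square_integrable v" using v by (simp add: has_L2_sum_wave_iff L2_torus_iff)
  define w where "w x = u x - v x" for x
  have wsq: "square_integrable w" unfolding w_def by (intro square_integrable_diff sq vsq)
  have w1: "integrable torus w"
    using square_integrable_mult_integrable [OF wsq square_integrable_wave [of 0]] by (simp add: wave_def)
  have "(\<integral>x. w x * wave n x \<partial>torus) = 0" for n
  proof -
    have "(\<integral>x. w x * cnj (wave (- n) x) \<partial>torus) =
        (\<integral>x. u x * cnj (wave (- n) x) \<partial>torus) - (\<integral>x. v x * cnj (wave (- n) x) \<partial>torus)"
      using square_integrable_mult_integrable [OF sq square_integrable_wave [of n]]
        square_integrable_mult_integrable [OF vsq square_integrable_wave [of n]]
      by (simp add: w_def left_diff_distrib cnj_wave)
    also have "\<dots> = 0"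
      unfolding integral_mult_cnj_wave by (simp add: has_L2_sum_wave_energy(1) [OF v])
    finally show ?thesis by (simp add: cnj_wave)
  qed
  from orthogonal_to_waves_imp_zero [OF w1 this] have ae: "AE x in torus. u x = v x"
    by (simp add: w_def)
  have m: "(\<lambda>x. (cmod (f x - trig_sum c F x))\<^sup>2) \<in> borel_measurable torus"
    if "square_integrable f" for f c F
  proof (rule borel_measurable_integrable)
    show "integrable torus (\<lambda>x. (cmod (f x - trig_sum c F x))\<^sup>2)"
      using square_integrable_diff [OF that square_integrable_trig_sum [of c F]]
      unfolding square_integrable_def by (rule conjunct2)
  qed
  have "energy (\<lambda>x. u x - trig_sum c F x) = energy (\<lambda>x. v x - trig_sum c F x)" for c F
    unfolding energy_def
  proof (rule integral_cong_AE [OF m [OF sq] m [OF vsq]])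
    show "AE x in torus. (cmod (u x - trig_sum c F x))\<^sup>2 = (cmod (v x - trig_sum c F x))\<^sup>2"
      using ae by eventually_elim simp
  qed
  then have "(\<lambda>F. energy (\<lambda>x. u x - trig_sum (fourier_coeff u) F x))
      = (\<lambda>F. energy (\<lambda>x. v x - trig_sum (fourier_coeff u) F x))"
    by blast
  then show ?thesis
    using v u unfolding has_L2_sum_wave_iff by (simp only:)
qed

section \<open>Weighted energy of a pair of opposite modes\<close>

lemma positive_seq_bounded_below:
  fixes x :: "nat \<Rightarrow> real"
  assumes pos: "\<And>k. x k > 0" and lim: "x \<longlonglongrightarrow> l" and l: "l > 0"
  obtains c where "c > 0" and "\<And>k. c \<le> x k"
proof -
  have "(\<lambda>k. inverse (x k)) \<longlonglongrightarrow> inverse l" using lim l by (intro tendsto_inverse) auto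
  then have "Bseq (\<lambda>k. inverse (x k))" by (rule convergent_imp_Bseq [OF convergentI])
  then obtain K where K: "K > 0" "\<And>k. \<bar>inverse (x k)\<bar> \<le> K" unfolding Bseq_def by auto
  have "inverse K \<le> x k" for k
    using K(2) [of k] K(1) pos [of k] by (simp add: field_simps)
  with K(1) show ?thesis by (intro that [of "inverse K"]) auto
qed

lemma AE_torus_countable: "countable X \<Longrightarrow> AE x in torus. x \<notin> X"
  using AE_ball_countable [of X "\<lambda>x y. x \<noteq> y" torus] AE_torus_neq by auto

lemma integrable_weight_mult:
  fixes f :: "real \<Rightarrow> 'a::{banach, second_countable_topology}"
  assumes \<beta>: "\<beta> \<in> borel_measurable torus" "\<And>x. 0 \<le> \<beta> x" "\<And>x. \<beta> x \<le> 1" and f: "integrable torus f"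
  shows "integrable torus (\<lambda>x. \<beta> x *\<^sub>R f x)"
proof (rule Bochner_Integration.integrable_bound [OF f])
  show "(\<lambda>x. \<beta> x *\<^sub>R f x) \<in> borel_measurable torus"
    by (intro borel_measurable_scaleR \<beta> borel_measurable_integrable f)
  show "AE x in torus. norm (\<beta> x *\<^sub>R f x) \<le> norm (f x)"
    using \<beta> by (intro AE_I2) (simp add: mult_left_le_one_le)
qed

text \<open>Equality would force \<open>cos (n x - \<theta>) = 1\<close>, for a fixed phase \<open>\<theta>\<close>, at almost every point where the
weight is positive. The equation holds only on a countable set, whereas the weight is positive on a
set of positive measure.\<close>

lemma cmod_weight_fourier_less:
  assumes \<beta>: "\<beta> \<in> borel_measurable torus" "\<And>x. 0 \<le> \<beta> x" "\<And>x. \<beta> x \<le> 1"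
    and pos: "(\<integral>x. \<beta> x \<partial>torus) > 0" and n: "n \<noteq> 0"
  shows "cmod (\<integral>x. \<beta> x *\<^sub>R wave n x \<partial>torus) < (\<integral>x. \<beta> x \<partial>torus)"
proof (rule ccontr)
  define I where "I = (\<integral>x. \<beta> x *\<^sub>R wave n x \<partial>torus)"
  assume "\<not> ?thesis"
  then have ge: "(\<integral>x. \<beta> x \<partial>torus) \<le> cmod I" by (simp add: I_def)
  have wave1: "integrable torus (wave n)" by (rule integrable_torus_bounded [of _ 1]) auto
  have int1: "integrable torus \<beta>" by (rule integrable_torus_bounded [of _ 1]) (use \<beta> in auto)
  \<comment> \<open>After rotation by the phase of \<open>I\<close>, the coefficient is the integral of \<open>\<beta>\<close> times a cosine.\<close>
  define \<theta> where "\<theta> = Arg I"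
  have I0: "I \<noteq> 0" using ge pos by auto
  have rot: "cis (- \<theta>) * I = of_real (cmod I)"
    using rcis_cmod_Arg [of I] unfolding \<theta>_def rcis_def
    by (metis (no_types, lifting) cis_mult cis_zero add.left_inverse mult.left_commute mult.right_neutral)
  have iw: "integrable torus (\<lambda>x. \<beta> x *\<^sub>R (cis (- \<theta>) * wave n x))"
    by (intro integrable_weight_mult \<beta> integrable_mult_right wave1)
  have Re: "Re (\<beta> x *\<^sub>R (cis (- \<theta>) * wave n x)) = \<beta> x * cos (of_int n * x - \<theta>)" for x
    by (simp add: wave_eq_cis cis_mult algebra_simps cos_diff)
  have "(\<integral>x. \<beta> x *\<^sub>R (cis (- \<theta>) * wave n x) \<partial>torus) = of_real (cmod I)"
    unfolding mult_scaleR_right [symmetric] integral_mult_right_zero I_def [symmetric] by (rule rot)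
  then have eq: "(\<integral>x. \<beta> x * cos (of_int n * x - \<theta>) \<partial>torus) = cmod I"
    using integral_Re [OF iw] unfolding Re by simp
  have ic: "integrable torus (\<lambda>x. \<beta> x * cos (of_int n * x - \<theta>))"
    using integrable_Re [OF iw] unfolding Re .
  define g where "g x = \<beta> x - \<beta> x * cos (of_int n * x - \<theta>)" for x
  have g0: "g x \<ge> 0" for x
    using mult_left_le [OF cos_le_one \<beta>(2)] by (simp add: g_def)
  have ig: "integrable torus g" unfolding g_def by (intro Bochner_Integration.integrable_diff int1 ic)
  have "(\<integral>x. g x \<partial>torus) \<le> 0"
    unfolding g_def using ge by (simp add: Bochner_Integration.integral_diff [OF int1 ic] eq)
  moreover have "(\<integral>x. g x \<partial>torus) \<ge> 0" using g0 by (intro Bochner_Integration.integral_nonneg) auto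
  ultimately have "(\<integral>x. g x \<partial>torus) = 0" by simp
  then have "AE x in torus. g x = 0"
    using integral_nonneg_eq_0_iff_AE [OF ig] g0 by simp
  moreover have "AE x in torus. x \<notin> range (\<lambda>k::int. (\<theta> + of_int k * 2 * pi) / of_int n)"
    by (rule AE_torus_countable) simp
  ultimately have "AE x in torus. \<beta> x = 0"
  proof eventually_elim
    case (elim x)
    have "cos (of_int n * x - \<theta>) \<noteq> 1"
    proof
      assume "cos (of_int n * x - \<theta>) = 1"
      then obtain k :: int where "of_int n * x - \<theta> = of_int k * 2 * pi"
        unfolding cos_one_2pi_int by blast
      then have "x = (\<theta> + of_int k * 2 * pi) / of_int n" using n by (simp add: field_simps)
      then show False using elim(2) by blast
    qed
    moreover have "\<beta> x * (1 - cos (of_int n * x - \<theta>)) = 0"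
      using elim(1) by (simp add: g_def right_diff_distrib)
    ultimately show ?case by simp
  qed
  then have "(\<integral>x. \<beta> x \<partial>torus) = 0" by (rule integral_eq_zero_AE)
  with pos show False by simp
qed

text \<open>Each single gap is positive by the preceding lemma; uniformity in \<open>k\<close> is the Riemann-Lebesgue lemma,
which for a bounded weight follows from Bessel's inequality.\<close>

lemma weight_fourier_uniform_gap:
  assumes \<beta>: "\<beta> \<in> borel_measurable torus" "\<And>x. 0 \<le> \<beta> x" "\<And>x. \<beta> x \<le> 1"
    and pos: "(\<integral>x. \<beta> x \<partial>torus) > 0"
  obtains \<kappa> where "\<kappa> > 0"
    and "\<And>k. \<kappa> \<le> (\<integral>x. \<beta> x \<partial>torus) - cmod (\<integral>x. \<beta> x *\<^sub>R wave (2 * (int k + 1)) x \<partial>torus)"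
proof -
  define B where "B = (\<integral>x. \<beta> x \<partial>torus)"
  define I where "I k = (\<integral>x. \<beta> x *\<^sub>R wave (2 * (int k + 1)) x \<partial>torus)" for k
  have sq: "square_integrable (\<lambda>x. complex_of_real (\<beta> x))"
    by (rule square_integrable_bounded [of _ 1]) (use \<beta> in auto)
  have I_eq: "I k = 2 * pi * fourier_coeff (\<lambda>x. complex_of_real (\<beta> x)) (- (2 * (int k + 1)))" for k
    unfolding I_def integral_mult_cnj_wave [symmetric] cnj_wave by (simp add: scaleR_conv_of_real add.commute)
  have "summable (\<lambda>k. (cmod (I k))\<^sup>2)"
  proof (rule summableI_nonneg_bounded)
    fix m
    define F where "F = (\<lambda>k. - (2 * (int k + 1))) ` {..<m}"
    have "(\<Sum>k<m. (cmod (I k))\<^sup>2) = (2 * pi)\<^sup>2 * (\<Sum>n\<in>F. (cmod (fourier_coeff (\<lambda>x. complex_of_real (\<beta> x)) n))\<^sup>2)"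
      unfolding F_def by (subst sum.reindex) (auto simp: inj_on_def I_eq norm_mult power_mult_distrib sum_distrib_left)
    also have "\<dots> = 2 * pi * (2 * pi * (\<Sum>n\<in>F. (cmod (fourier_coeff (\<lambda>x. complex_of_real (\<beta> x)) n))\<^sup>2))"
      by (simp add: power2_eq_square)
    also have "\<dots> \<le> 2 * pi * energy (\<lambda>x. complex_of_real (\<beta> x))"
      by (intro mult_left_mono bessel sq) (auto simp: F_def)
    finally show "(\<Sum>k<m. (cmod (I k))\<^sup>2) \<le> 2 * pi * energy (\<lambda>x. complex_of_real (\<beta> x))" .
  qed auto
  then have "(\<lambda>k. (cmod (I k))\<^sup>2) \<longlonglongrightarrow> 0" by (rule summable_LIMSEQ_zero)
  then have "(\<lambda>k. sqrt ((cmod (I k))\<^sup>2)) \<longlonglongrightarrow> sqrt 0" by (rule tendsto_real_sqrt)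
  then have "(\<lambda>k. cmod (I k)) \<longlonglongrightarrow> 0" by simp
  then have "(\<lambda>k. B - cmod (I k)) \<longlonglongrightarrow> B - 0" by (intro tendsto_intros)
  moreover have "B - cmod (I k) > 0" for k
    using cmod_weight_fourier_less [OF \<beta> pos, of "2 * (int k + 1)"] by (simp add: B_def I_def)
  ultimately obtain c where "c > 0" "\<And>k. c \<le> B - cmod (I k)"
    using positive_seq_bounded_below [of "\<lambda>k. B - cmod (I k)" B] pos by (auto simp: B_def)
  then show ?thesis unfolding B_def I_def by (rule that)
qed

text \<open>The waves \<open>n\<close> and \<open>- n\<close> oscillate in time with the same frequency, so time averaging cannot
separate them; the weight in \<open>x\<close> does, because the cross term involves only its Fourier coefficient of
order \<open>2 n\<close>.\<close>

lemma weighted_pair_energy: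
  assumes \<beta>: "\<beta> \<in> borel_measurable torus" "\<And>x. 0 \<le> \<beta> x" "\<And>x. \<beta> x \<le> 1"
  shows "((\<integral>x. \<beta> x \<partial>torus) - cmod (\<integral>x. \<beta> x *\<^sub>R wave (2 * n) x \<partial>torus)) * ((cmod p)\<^sup>2 + (cmod q)\<^sup>2)
    \<le> (\<integral>x. \<beta> x * (cmod (p * wave n x + q * wave (- n) x))\<^sup>2 \<partial>torus)"
proof -
  define B where "B = (\<integral>x. \<beta> x \<partial>torus)"
  define I where "I = (\<integral>x. \<beta> x *\<^sub>R wave (2 * n) x \<partial>torus)"
  have int1: "integrable torus \<beta>" by (rule integrable_torus_bounded [of _ 1]) (use \<beta> in auto)
  have wave1: "integrable torus (wave (2 * n))" by (rule integrable_torus_bounded [of _ 1]) auto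
  have iw: "integrable torus (\<lambda>x. (2 * (p * cnj q)) * (\<beta> x *\<^sub>R wave (2 * n) x))"
    by (intro integrable_mult_right integrable_weight_mult \<beta> wave1)
  have "\<beta> x * (cmod (p * wave n x + q * wave (- n) x))\<^sup>2 =
      \<beta> x * ((cmod p)\<^sup>2 + (cmod q)\<^sup>2) + Re ((2 * (p * cnj q)) * (\<beta> x *\<^sub>R wave (2 * n) x))" for x
  proof -
    have *: "(cmod (a + b))\<^sup>2 = (cmod a)\<^sup>2 + (cmod b)\<^sup>2 + Re (2 * (a * cnj b))" for a b :: complex
      unfolding cmod_power2 by (simp add: power2_eq_square algebra_simps)
    have "p * wave n x * cnj (q * wave (- n) x) = p * cnj q * wave (2 * n) x"
    proof -
      have "wave (2 * n) x = wave n x * wave n x" by (simp add: wave_mult)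
      then show ?thesis by (simp add: cnj_wave mult_ac)
    qed
    then have "(cmod (p * wave n x + q * wave (- n) x))\<^sup>2
        = (cmod p)\<^sup>2 + (cmod q)\<^sup>2 + Re (2 * (p * cnj q * wave (2 * n) x))"
      unfolding * by (simp only: norm_mult cmod_wave mult_1_right)
    then show ?thesis
      by (simp only: mult_scaleR_right scaleR_complex.simps distrib_left mult.assoc)
  qed
  then have "(\<integral>x. \<beta> x * (cmod (p * wave n x + q * wave (- n) x))\<^sup>2 \<partial>torus)
     = B * ((cmod p)\<^sup>2 + (cmod q)\<^sup>2) + Re (2 * (p * cnj q) * I)"
    using Bochner_Integration.integral_add [OF integrable_mult_left [OF int1] integrable_Re [OF iw]]
      integral_Re [OF iw]
    by (simp only: integral_mult_left_zero integral_mult_right_zero B_def I_def)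
  moreover have "- Re (2 * (p * cnj q) * I) \<le> cmod I * ((cmod p)\<^sup>2 + (cmod q)\<^sup>2)"
  proof -
    have "- Re (2 * (p * cnj q) * I) \<le> cmod (2 * (p * cnj q) * I)"
      using abs_Re_le_cmod [of "2 * (p * cnj q) * I"] by linarith
    also have "\<dots> = cmod I * (2 * cmod p * cmod q)" by (simp add: norm_mult)
    also have "\<dots> \<le> cmod I * ((cmod p)\<^sup>2 + (cmod q)\<^sup>2)"
      by (intro mult_left_mono sum_squares_bound) auto
    finally show ?thesis .
  qed
  ultimately show ?thesis unfolding B_def [symmetric] I_def [symmetric] by (simp add: left_diff_distrib)
qed

text \<open>The terms \<open>n\<close> and \<open>- n\<close> share the frequency \<open>|n|\<^sup>\<alpha>\<close> and are grouped, so that distinct indices \<open>k\<close> carry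
distinct frequencies.\<close>

definition fold_modes :: "(int \<Rightarrow> 'a::comm_monoid_add) \<Rightarrow> nat \<Rightarrow> 'a" where
  "fold_modes g k = (if k = 0 then g 0 else g (int k) + g (- int k))"

lemma sum_symmetric_eq: "(\<Sum>n\<in>{- int M..int M}. g n) = (\<Sum>k\<in>{0..<Suc M}. fold_modes g k)"
proof (induction M)
  case 0
  show ?case by (simp add: fold_modes_def)
next
  case (Suc M)
  have "{- int (Suc M)..int (Suc M)} = insert (int (Suc M)) (insert (- int (Suc M)) {- int M..int M})" by auto
  then have "(\<Sum>n\<in>{- int (Suc M)..int (Suc M)}. g n) = g (int (Suc M)) + (g (- int (Suc M)) + (\<Sum>n\<in>{- int M..int M}. g n))"
    by simp
  also have "\<dots> = (\<Sum>k\<in>{0..<Suc M}. fold_modes g k) + fold_modes g (Suc M)"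
    unfolding Suc.IH by (simp add: fold_modes_def add_ac)
  finally show ?case by (simp add: sum.atLeast0_lessThan_Suc)
qed

lemma weighted_modes_energy:
  assumes \<beta>: "\<beta> \<in> borel_measurable torus" "\<And>x. 0 \<le> \<beta> x" "\<And>x. \<beta> x \<le> 1"
    and \<kappa>: "\<kappa> > 0" "\<And>k. \<kappa> \<le> (\<integral>x. \<beta> x \<partial>torus) - cmod (\<integral>x. \<beta> x *\<^sub>R wave (2 * (int k + 1)) x \<partial>torus)"
  shows "\<kappa> * (\<Sum>n\<in>{- int M..int M}. (cmod (c n))\<^sup>2)
    \<le> (\<integral>x. \<beta> x * (\<Sum>k\<in>{0..<Suc M}. (cmod (fold_modes (\<lambda>n. c n * wave n x) k))\<^sup>2) \<partial>torus)"
proof -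
  have mode: "\<kappa> * fold_modes (\<lambda>n. (cmod (c n))\<^sup>2) k \<le> (\<integral>x. \<beta> x * (cmod (fold_modes (\<lambda>n. c n * wave n x) k))\<^sup>2 \<partial>torus)" for k
  proof (cases k)
    case 0
    have "\<kappa> * (cmod (c 0))\<^sup>2 \<le> (\<integral>x. \<beta> x \<partial>torus) * (cmod (c 0))\<^sup>2"
      using \<kappa>(2) [of 0] by (intro mult_right_mono) (auto intro: order_trans)
    then show ?thesis by (simp add: 0 fold_modes_def norm_mult)
  next
    case (Suc j)
    have "\<kappa> * ((cmod (c (int k)))\<^sup>2 + (cmod (c (- int k)))\<^sup>2) \<le>
      ((\<integral>x. \<beta> x \<partial>torus) - cmod (\<integral>x. \<beta> x *\<^sub>R wave (2 * int k) x \<partial>torus)) * ((cmod (c (int k)))\<^sup>2 + (cmod (c (- int k)))\<^sup>2)"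
      using \<kappa>(2) [of j] by (intro mult_right_mono) (auto simp: Suc add.commute)
    also note weighted_pair_energy [OF \<beta>]
    finally show ?thesis by (simp add: fold_modes_def Suc del: of_nat_Suc)
  qed
  have int: "integrable torus (\<lambda>x. \<beta> x * (cmod (fold_modes (\<lambda>n. c n * wave n x) k))\<^sup>2)" for k
  proof -
    have "square_integrable (\<lambda>x. fold_modes (\<lambda>n. c n * wave n x) k)"
      unfolding fold_modes_def
      by (cases "k = 0") (simp_all add: square_integrable_add square_integrable_cmult square_integrable_wave)
    then have "integrable torus (\<lambda>x. (cmod (fold_modes (\<lambda>n. c n * wave n x) k))\<^sup>2)"
      unfolding square_integrable_def by (rule conjunct2)
    from integrable_weight_mult [OF \<beta> this] show ?thesis by (simp only: real_scaleR_def)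
  qed
  have "\<kappa> * (\<Sum>n\<in>{- int M..int M}. (cmod (c n))\<^sup>2) = (\<Sum>k\<in>{0..<Suc M}. \<kappa> * fold_modes (\<lambda>n. (cmod (c n))\<^sup>2) k)"
    unfolding sum_symmetric_eq sum_distrib_left ..
  also have "\<dots> \<le> (\<Sum>k\<in>{0..<Suc M}. \<integral>x. \<beta> x * (cmod (fold_modes (\<lambda>n. c n * wave n x) k))\<^sup>2 \<partial>torus)"
    by (rule sum_mono [OF mode])
  also have "\<dots> = (\<integral>x. (\<Sum>k\<in>{0..<Suc M}. \<beta> x * (cmod (fold_modes (\<lambda>n. c n * wave n x) k))\<^sup>2) \<partial>torus)"
    by (rule Bochner_Integration.integral_sum [symmetric]) (rule int)
  finally show ?thesis by (simp only: sum_distrib_left)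
qed

section \<open>Observability of the fractional flow\<close>

text \<open>This is where \<open>\<alpha> > 1\<close> enters: from \<open>x\<^sup>\<alpha> = x x\<^sup>\<alpha>\<^sup>-\<^sup>1\<close> the gap above \<open>k\<close> is at least \<open>k\<^sup>\<alpha>\<^sup>-\<^sup>1\<close>.\<close>

lemma powr_gaps:
  fixes \<alpha> :: real
  assumes \<alpha>: "\<alpha> > 1"
  shows "real k powr \<alpha> < real (Suc k) powr \<alpha>"
    and "filterlim (\<lambda>k. real (Suc k) powr \<alpha> - real k powr \<alpha>) at_top sequentially"
proof -
  show "real k powr \<alpha> < real (Suc k) powr \<alpha>"
    using \<alpha> by (intro powr_less_mono2) auto
  have gap: "real k powr (\<alpha> - 1) \<le> real (Suc k) powr \<alpha> - real k powr \<alpha>" if "k > 0" for k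
  proof -
    have e: "x powr \<alpha> = x * x powr (\<alpha> - 1)" if "x > 0" for x :: real
      using that by (simp add: powr_mult_base)
    have "real (Suc k) * real k powr (\<alpha> - 1) \<le> real (Suc k) * real (Suc k) powr (\<alpha> - 1)"
      using \<alpha> by (intro mult_left_mono powr_mono2) auto
    then show ?thesis using e [of "real k"] e [of "real (Suc k)"] that by (simp add: algebra_simps)
  qed
  have "filterlim (\<lambda>k. exp ((\<alpha> - 1) * ln (real k))) at_top sequentially"
    using \<alpha> by (intro filterlim_compose [OF exp_at_top] filterlim_tendsto_pos_mult_at_top [OF tendsto_const]
        filterlim_compose [OF ln_at_top] filterlim_real_sequentially) auto
  then show "filterlim (\<lambda>k. real (Suc k) powr \<alpha> - real k powr \<alpha>) at_top sequentially"
  proof (rule filterlim_at_top_mono)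
    show "\<forall>\<^sub>F k in sequentially. exp ((\<alpha> - 1) * ln (real k)) \<le> real (Suc k) powr \<alpha> - real k powr \<alpha>"
      using eventually_gt_at_top [of 0]
    proof eventually_elim
      case (elim k)
      then show ?case using gap [OF elim] by (simp add: powr_def)
    qed
  qed
qed


text \<open>For each fixed \<open>x\<close> the solution is an exponential sum in time whose coefficients are the grouped modes
at \<open>x\<close>. The scalar inequality holds there with a constant independent of \<open>x\<close>; integrating it against
the weight and exchanging the integrals reduces the claim to the individual pairs of modes.\<close>

lemma schrodinger_trig_observability:
  assumes \<alpha>: "\<alpha> > 1" and T: "T > 0"
    and \<beta>: "\<beta> \<in> borel_measurable torus" "\<And>x. 0 \<le> \<beta> x" "\<And>x. \<beta> x \<le> 1"
    and pos: "(\<integral>x. \<beta> x \<partial>torus) > 0"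
  defines "evolved c t n \<equiv> c n * exp (\<i> * of_real (t * \<bar>real_of_int n\<bar> powr \<alpha>))"
  defines "G c M t \<equiv> (\<integral>x. \<beta> x * (cmod (trig_sum (evolved c t) {- int M..int M} x))\<^sup>2 \<partial>torus)"
  shows "integrable (lebesgue_on {0..T}) (G c M)"
    and "\<exists>K>0. \<forall>c M. K * (\<Sum>n\<in>{- int M..int M}. (cmod (c n))\<^sup>2) \<le> (\<integral>t. G c M t \<partial>lebesgue_on {0..T})"
proof -
  let ?P = "lebesgue_on {0..T}"
  define \<omega> where "\<omega> k = real k powr \<alpha>" for k
  define a where "a c x = fold_modes (\<lambda>n. c n * wave n x)" for c x
  define f where "f c M p = \<beta> (snd p) * (cmod (exp_sum \<omega> (a c (snd p)) 0 (Suc M) (fst p)))\<^sup>2" for c M p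
  have trig: "trig_sum (evolved c t) {- int M..int M} x = exp_sum \<omega> (a c x) 0 (Suc M) t" for c M t x
  proof -
    have "fold_modes (\<lambda>n. evolved c t n * wave n x) k = a c x k * cis (\<omega> k * t)" for k
      by (simp add: fold_modes_def evolved_def a_def \<omega>_def cis_conv_exp algebra_simps)
    then show ?thesis unfolding trig_sum_def sum_symmetric_eq exp_sum_def by simp
  qed
  then have G: "G c M t = (\<integral>x. f c M (t, x) \<partial>torus)" for c M t
    by (simp add: G_def f_def)
  have finP: "finite_measure ?P" by (intro finite_measure_lebesgue_on) simp
  interpret PT: pair_sigma_finite ?P torus
    using finP finite_measure_torus
    by (intro pair_sigma_finite.intro finite_measure.axioms)
  have a_meas [measurable]: "(\<lambda>x. a c x k) \<in> borel_measurable torus" for c k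
    unfolding a_def fold_modes_def by (cases "k = 0") auto
  have cis_meas [measurable]: "(\<lambda>t. cis (\<omega> k * t)) \<in> borel_measurable ?P" for k
    by (intro continuous_imp_measurable_on_sets_lebesgue continuous_intros) auto
  have f_meas: "f c M \<in> borel_measurable (?P \<Otimes>\<^sub>M torus)" for c M
    unfolding f_def exp_sum_def using \<beta>(1) by measurable
  have a_le: "cmod (a c x k) \<le> cmod (c (int k)) + cmod (c (- int k))" for c x k
    using norm_triangle_ineq [of "c (int k) * wave (int k) x" "c (- int k) * wave (- int k) x"]
    by (cases "k = 0") (auto simp: a_def fold_modes_def norm_mult)
  have f_int: "integrable (?P \<Otimes>\<^sub>M torus) (f c M)" for c M
  proof (rule finite_measure.integrable_const_bound)
    show "finite_measure (?P \<Otimes>\<^sub>M torus)"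
      by (rule finite_measure_pair_measure [OF finite_measure_torus finP])
    define R where "R = (\<Sum>k\<in>{0..<Suc M}. cmod (c (int k)) + cmod (c (- int k)))"
    show "AE p in ?P \<Otimes>\<^sub>M torus. norm (f c M p) \<le> R\<^sup>2"
    proof (rule AE_I2)
      fix p :: "real \<times> real"
      have "cmod (exp_sum \<omega> (a c (snd p)) 0 (Suc M) (fst p)) \<le> R"
        unfolding exp_sum_def R_def
        by (rule sum_norm_le) (simp only: norm_mult norm_cis mult_1_right a_le)
      then have "(cmod (exp_sum \<omega> (a c (snd p)) 0 (Suc M) (fst p)))\<^sup>2 \<le> R\<^sup>2"
        by (rule power_mono) simp
      then show "norm (f c M p) \<le> R\<^sup>2"
        using mult_mono [OF \<beta>(3) _ zero_le_one zero_le_power2] \<beta>(2) by (simp add: f_def abs_mult)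
    qed
  qed (rule f_meas)
  show "integrable ?P (G c M)"
    using PT.integrable_fst' [OF f_int [of c M]] by (simp only: G [abs_def])
  obtain c1 where c1: "c1 > 0" and obs: "\<And>a M. c1 * (\<Sum>k\<in>{0..<M}. (cmod (a k))\<^sup>2) \<le>
      integral {0..T} (\<lambda>t. (cmod (exp_sum \<omega> a 0 M t))\<^sup>2)"
    using observable_if_gaps_at_top [OF _ _ T, of \<omega>] powr_gaps [OF \<alpha>]
    unfolding observable_def \<omega>_def by blast
  obtain \<kappa> where \<kappa>: "\<kappa> > 0"
      "\<And>k. \<kappa> \<le> (\<integral>x. \<beta> x \<partial>torus) - cmod (\<integral>x. \<beta> x *\<^sub>R wave (2 * (int k + 1)) x \<partial>torus)"
    using weight_fourier_uniform_gap [OF \<beta> pos] by blast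
  show "\<exists>K>0. \<forall>c M. K * (\<Sum>n\<in>{- int M..int M}. (cmod (c n))\<^sup>2) \<le> (\<integral>t. G c M t \<partial>?P)"
  proof (intro exI [of _ "c1 * \<kappa>"] conjI allI)
    fix c M
    define Q where "Q x = (\<Sum>k\<in>{0..<Suc M}. (cmod (a c x k))\<^sup>2)" for x
    have slice: "\<beta> x * (c1 * Q x) \<le> (\<integral>t. f c M (t, x) \<partial>?P)" for x
    proof -
      have cont: "continuous_on {0..T} (\<lambda>t. (cmod (exp_sum \<omega> (a c x) 0 (Suc M) t))\<^sup>2)"
        by (intro continuous_intros)
      have "(\<integral>t. (cmod (exp_sum \<omega> (a c x) 0 (Suc M) t))\<^sup>2 \<partial>?P)
          = integral {0..T} (\<lambda>t. (cmod (exp_sum \<omega> (a c x) 0 (Suc M) t))\<^sup>2)"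
        by (rule lebesgue_integral_eq_integral [OF continuous_imp_integrable_real [OF cont]]) simp
      then have "c1 * Q x \<le> (\<integral>t. (cmod (exp_sum \<omega> (a c x) 0 (Suc M) t))\<^sup>2 \<partial>?P)"
        using obs [where M = "Suc M" and a = "a c x"] by (simp only: Q_def)
      then show ?thesis
        unfolding f_def fst_conv snd_conv integral_mult_right_zero by (intro mult_left_mono \<beta>)
    qed
    have Q_bound: "Q x \<le> (\<Sum>k\<in>{0..<Suc M}. (cmod (c (int k)) + cmod (c (- int k)))\<^sup>2)" (is "_ \<le> ?q") for x
      unfolding Q_def by (intro sum_mono power_mono a_le norm_ge_zero)
    have Q_int: "integrable torus Q"
    proof (rule integrable_torus_bounded [of _ ?q])
      show "Q \<in> borel_measurable torus" unfolding Q_def by measurable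
      have "Q x \<ge> 0" for x by (simp add: Q_def sum_nonneg)
      then show "norm (Q x) \<le> ?q" for x using Q_bound [of x] by simp
    qed
    have "c1 * \<kappa> * (\<Sum>n\<in>{- int M..int M}. (cmod (c n))\<^sup>2) \<le> c1 * (\<integral>x. \<beta> x * Q x \<partial>torus)"
      using mult_left_mono [OF weighted_modes_energy [OF \<beta> \<kappa>, of c M], of c1] c1
      by (simp only: Q_def a_def mult.assoc less_imp_le)
    also have "\<dots> = (\<integral>x. \<beta> x * (c1 * Q x) \<partial>torus)"
      by (subst integral_mult_right_zero [symmetric]) (simp only: mult.left_commute)
    also have "\<dots> \<le> (\<integral>x. (\<integral>t. f c M (t, x) \<partial>?P) \<partial>torus)"
    proof (rule integral_mono [OF _ _ slice])
      show "integrable torus (\<lambda>x. \<beta> x * (c1 * Q x))"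
        using integrable_weight_mult [OF \<beta> integrable_mult_right [OF Q_int, of c1]] by (simp only: real_scaleR_def)
      show "integrable torus (\<lambda>x. \<integral>t. f c M (t, x) \<partial>?P)"
        using PT.integrable_snd [of "\<lambda>t x. f c M (t, x)"] f_int [of c M] by simp
    qed
    also have "\<dots> = (\<integral>t. (\<integral>x. f c M (t, x) \<partial>torus) \<partial>?P)"
      using PT.Fubini_integral [of "\<lambda>t x. f c M (t, x)"] f_int [of c M] by simp
    finally show "c1 * \<kappa> * (\<Sum>n\<in>{- int M..int M}. (cmod (c n))\<^sup>2) \<le> (\<integral>t. G c M t \<partial>?P)"
      by (simp only: G)
  qed (use c1 \<kappa> in simp)
qed

lemma ennreal_integral_le_nn_integral:
  fixes f :: "'a \<Rightarrow> real"
  assumes f: "integrable M f"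
  shows "ennreal (\<integral>x. f x \<partial>M) \<le> (\<integral>\<^sup>+x. ennreal (f x) \<partial>M)"
proof -
  have m: "integrable M (\<lambda>x. max 0 (f x))" using f by simp
  have "(\<integral>x. f x \<partial>M) \<le> (\<integral>x. max 0 (f x) \<partial>M)" by (intro integral_mono f m) simp
  then have "ennreal (\<integral>x. f x \<partial>M) \<le> ennreal (\<integral>x. max 0 (f x) \<partial>M)" by (rule ennreal_leI)
  also have "\<dots> = (\<integral>\<^sup>+x. ennreal (max 0 (f x)) \<partial>M)"
    by (rule nn_integral_eq_integral [OF m, symmetric]) simp
  also have "\<dots> = (\<integral>\<^sup>+x. ennreal (f x) \<partial>M)"
    by (intro nn_integral_cong) (simp add: max_def ennreal_neg)
  finally show ?thesis .
qed

lemma schrodinger_flow_L2_sum: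
  fixes \<alpha> :: real
  assumes u: "u0 \<in> L2_torus"
  defines "c t n \<equiv> fourier_coeff u0 n * exp (\<i> * of_real (t * \<bar>real_of_int n\<bar> powr \<alpha>))"
  shows "has_L2_sum (\<lambda>n x. c t n * exp (\<i> * of_int n * of_real x)) (schrodinger_flow \<alpha> t u0)"
proof -
  have "cmod (c t n) = cmod (fourier_coeff u0 n)" for n
    by (simp add: c_def norm_mult)
  then have "(\<lambda>n. (cmod (c t n))\<^sup>2) summable_on UNIV"
    using fourier_coeff_summable [of u0] u by (simp add: L2_torus_iff)
  from riesz_fischer [OF this] show ?thesis
    unfolding schrodinger_flow_def c_def by (rule someI_ex)
qed

text \<open>From \<open>|s|\<^sup>2 \<le> 2 |v|\<^sup>2 + 2 |v - s|\<^sup>2\<close> and a weight of at most \<open>1\<close>.\<close>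

lemma weighted_energy_lower_bound:
  assumes \<beta>: "\<beta> \<in> borel_measurable torus" "\<And>x. 0 \<le> \<beta> x" "\<And>x. \<beta> x \<le> 1"
    and v: "square_integrable v" and s: "square_integrable s"
  shows "(\<integral>x. \<beta> x * (cmod (s x))\<^sup>2 \<partial>torus) / 2 - energy (\<lambda>x. v x - s x) \<le> (\<integral>x. \<beta> x * (cmod (v x))\<^sup>2 \<partial>torus)"
proof -
  have i: "integrable torus (\<lambda>x. \<beta> x * (cmod (w x))\<^sup>2)" if "square_integrable w" for w
  proof -
    from that have "integrable torus (\<lambda>x. (cmod (w x))\<^sup>2)"
      unfolding square_integrable_def by (rule conjunct2)
    from integrable_weight_mult [OF \<beta> this] show ?thesis by (simp only: real_scaleR_def)
  qed
  have d: "integrable torus (\<lambda>x. (cmod (v x - s x))\<^sup>2)"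
    using square_integrable_diff [OF v s] unfolding square_integrable_def by (rule conjunct2)
  have "(\<integral>x. \<beta> x * (cmod (s x))\<^sup>2 / 2 - (cmod (v x - s x))\<^sup>2 \<partial>torus) \<le> (\<integral>x. \<beta> x * (cmod (v x))\<^sup>2 \<partial>torus)"
  proof (rule integral_mono)
    fix x
    have "cmod (s x) \<le> cmod (v x) + cmod (v x - s x)"
      using norm_triangle_ineq4 [of "v x" "v x - s x"] by simp
    then have "(cmod (s x))\<^sup>2 \<le> (cmod (v x) + cmod (v x - s x))\<^sup>2" by (rule power_mono) simp
    also have "\<dots> \<le> 2 * (cmod (v x))\<^sup>2 + 2 * (cmod (v x - s x))\<^sup>2"
      using sum_squares_bound [of "cmod (v x)" "cmod (v x - s x)"] by (simp add: power2_sum)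
    finally have "\<beta> x * ((cmod (s x))\<^sup>2 / 2) \<le> \<beta> x * ((cmod (v x))\<^sup>2 + (cmod (v x - s x))\<^sup>2)"
      by (intro mult_left_mono \<beta>) simp
    also have "\<dots> \<le> \<beta> x * (cmod (v x))\<^sup>2 + (cmod (v x - s x))\<^sup>2"
      using mult_right_mono [OF \<beta>(3) zero_le_power2, of x "cmod (v x - s x)"] by (simp add: distrib_left)
    finally show "\<beta> x * (cmod (s x))\<^sup>2 / 2 - (cmod (v x - s x))\<^sup>2 \<le> \<beta> x * (cmod (v x))\<^sup>2" by simp
  qed (intro Bochner_Integration.integrable_diff integrable_divide i d v s)+
  then show ?thesis
    unfolding energy_def by (simp only: Bochner_Integration.integral_diff [OF integrable_divide [OF i [OF s]] d] integral_divide_zero)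
qed

theorem theorem1p2:
  fixes \<alpha> T :: real and b :: "real \<Rightarrow> real"
  assumes "\<alpha> > 1" and "T > 0"
    and "b \<in> L1_torus"
    and "\<not> (AE x in torus. b x = 0)"
    and "AE x in torus. b x \<ge> 0"
  shows "\<exists>C>0. \<forall>u0\<in>L2_torus.
    ennreal ((L2_norm_torus u0)\<^sup>2) \<le> ennreal C *
      (\<integral>\<^sup>+t. (\<integral>\<^sup>+x. ennreal (b x * (cmod (schrodinger_flow \<alpha> t u0 x))\<^sup>2) \<partial>torus)
        \<partial>lebesgue_on {0..T})"
proof -
  \<comment> \<open>A bounded weight below \<open>b\<close>: it keeps all weighted energies finite and still has positive integral.\<close>
  define \<beta> where "\<beta> x = max 0 (min (b x) 1)" for x
  have "integrable torus b" using assms(3) by (simp add: L1_torus_def)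
  then have "b \<in> borel_measurable torus" by (rule borel_measurable_integrable)
  then have \<beta>: "\<beta> \<in> borel_measurable torus" "\<And>x. 0 \<le> \<beta> x" "\<And>x. \<beta> x \<le> 1"
    unfolding \<beta>_def by auto
  have \<beta>_le: "AE x in torus. \<beta> x \<le> b x"
    using assms(5) by eventually_elim (simp add: \<beta>_def)
  have int: "integrable torus \<beta>" by (rule integrable_torus_bounded [of _ 1]) (use \<beta> in auto)
  have "(\<integral>x. \<beta> x \<partial>torus) \<noteq> 0"
  proof
    assume "(\<integral>x. \<beta> x \<partial>torus) = 0"
    then have "AE x in torus. \<beta> x = 0"
      using integral_nonneg_eq_0_iff_AE [OF int] \<beta>(2) by simp
    with assms(5) have "AE x in torus. b x = 0"
      by eventually_elim (auto simp: \<beta>_def max_def min_def split: if_splits)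
    with assms(4) show False by contradiction
  qed
  moreover have "(\<integral>x. \<beta> x \<partial>torus) \<ge> 0"
    by (rule Bochner_Integration.integral_nonneg) (rule \<beta>)
  ultimately have pos: "(\<integral>x. \<beta> x \<partial>torus) > 0" by simp
  note observability = schrodinger_trig_observability [OF assms(1,2) \<beta> pos]
  obtain K where K: "K > 0" and obs: "\<And>c M. K * (\<Sum>n\<in>{- int M..int M}. (cmod (c n))\<^sup>2) \<le>
      (\<integral>t. (\<integral>x. \<beta> x * (cmod (trig_sum (\<lambda>n. c n * exp (\<i> * of_real (t * \<bar>real_of_int n\<bar> powr \<alpha>)))
        {- int M..int M} x))\<^sup>2 \<partial>torus) \<partial>lebesgue_on {0..T})"
    using observability(2) by blast
  \<comment> \<open>The energy is \<open>2 \<pi>\<close> times the sum over the coefficients; another factor \<open>2\<close> is lost in passing from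
    partial sums to the flow.\<close>
  define C where "C = 4 * pi / K"
  show ?thesis
  proof (intro exI [of _ C] conjI ballI)
    show "C > 0" using K by (simp add: C_def)
    fix u0 assume u0: "u0 \<in> L2_torus"
    define c where "c = fourier_coeff u0"
    define ct where "ct t n = c n * exp (\<i> * of_real (t * \<bar>real_of_int n\<bar> powr \<alpha>))" for t n
    define v where "v t = schrodinger_flow \<alpha> t u0" for t
    define E where "E = energy u0"
    define G where "G M t = (\<integral>x. \<beta> x * (cmod (trig_sum (ct t) {- int M..int M} x))\<^sup>2 \<partial>torus)" for M t
    define \<sigma> where "\<sigma> M = (\<Sum>n\<in>{- int M..int M}. (cmod (c n))\<^sup>2)" for M
    define \<delta> where "\<delta> M = E - 2 * pi * \<sigma> M" for M
    define X where "X = (\<integral>\<^sup>+t. (\<integral>\<^sup>+x. ennreal (b x * (cmod (v t x))\<^sup>2) \<partial>torus) \<partial>lebesgue_on {0..T})"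
    have sum0: "((\<lambda>n. (cmod (c n))\<^sup>2) has_sum (E / (2 * pi))) UNIV"
      unfolding c_def E_def by (rule has_L2_sum_wave_energy(3) [OF fourier_series_converges [OF u0]])
    have G_int: "integrable (lebesgue_on {0..T}) (G M)" for M
      unfolding G_def ct_def by (rule observability(1))
    have KG: "K * \<sigma> M \<le> (\<integral>t. G M t \<partial>lebesgue_on {0..T})" for M
      unfolding G_def ct_def \<sigma>_def by (rule obs)
    have vsum: "has_L2_sum (\<lambda>n x. ct t n * exp (\<i> * of_int n * of_real x)) (v t)" for t
      unfolding ct_def v_def c_def by (rule schrodinger_flow_L2_sum [OF u0])
    have vsq: "square_integrable (v t)" for t
      using vsum by (simp add: has_L2_sum_wave_iff L2_torus_iff)
    have ct: "cmod (ct t n) = cmod (c n)" for t n by (simp add: ct_def norm_mult)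
    have Ev: "energy (v t) = E" for t
    proof -
      have "((\<lambda>n. (cmod (c n))\<^sup>2) has_sum (energy (v t) / (2 * pi))) UNIV"
        using has_L2_sum_wave_energy(3) [OF vsum [of t]] by (simp only: ct)
      from has_sum_unique [OF this sum0] show ?thesis by simp
    qed
    \<comment> \<open>The distance to the partial sum is the same at all times.\<close>
    have close: "energy (\<lambda>x. v t x - trig_sum (ct t) {- int M..int M} x) = \<delta> M" for t M
      using has_L2_sum_wave_energy(2) [OF vsum [of t], of "{- int M..int M}"]
      by (simp add: ct Ev \<delta>_def \<sigma>_def)
    \<comment> \<open>The integral in time is compared with that of the integrable function \<open>G M\<close>, pointwise in \<open>t\<close>, since
      the flow consists of representatives chosen separately at each time.\<close>
    have lower: "ennreal (G M t / 2 - \<delta> M) \<le> (\<integral>\<^sup>+x. ennreal (b x * (cmod (v t x))\<^sup>2) \<partial>torus)" for M t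
    proof -
      have vi: "integrable torus (\<lambda>x. \<beta> x * (cmod (v t x))\<^sup>2)"
      proof -
        have "integrable torus (\<lambda>x. (cmod (v t x))\<^sup>2)"
          using vsq [of t] unfolding square_integrable_def by (rule conjunct2)
        from integrable_weight_mult [OF \<beta> this] show ?thesis by (simp only: real_scaleR_def)
      qed
      have "ennreal (G M t / 2 - \<delta> M) \<le> ennreal (\<integral>x. \<beta> x * (cmod (v t x))\<^sup>2 \<partial>torus)"
        using weighted_energy_lower_bound [OF \<beta> vsq [of t] square_integrable_trig_sum [of "ct t" "{- int M..int M}"]]
        unfolding close G_def by (rule ennreal_leI)
      also have "\<dots> \<le> (\<integral>\<^sup>+x. ennreal (\<beta> x * (cmod (v t x))\<^sup>2) \<partial>torus)"
        by (rule ennreal_integral_le_nn_integral [OF vi])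
      also have "\<dots> \<le> (\<integral>\<^sup>+x. ennreal (b x * (cmod (v t x))\<^sup>2) \<partial>torus)"
        using \<beta>_le by (intro nn_integral_mono_AE) (auto elim!: eventually_mono intro!: ennreal_leI mult_right_mono)
      finally show ?thesis .
    qed
    have bound: "ennreal (K * \<sigma> M / 2 - T * \<delta> M) \<le> X" for M
    proof -
      have fin: "finite_measure (lebesgue_on {0..T})" by (intro finite_measure_lebesgue_on) simp
      have meas: "measure (lebesgue_on {0..T}) {0..T} = T"
        using assms(2) by (subst measure_restrict_space) auto
      have const: "integrable (lebesgue_on {0..T}) (\<lambda>t. \<delta> M)"
        by (rule finite_measure.integrable_const [OF fin])
      have "(\<integral>t. G M t / 2 - \<delta> M \<partial>lebesgue_on {0..T}) = (\<integral>t. G M t \<partial>lebesgue_on {0..T}) / 2 - T * \<delta> M"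
        by (simp add: Bochner_Integration.integral_diff [OF integrable_divide [OF G_int] const] meas)
      then have "K * \<sigma> M / 2 - T * \<delta> M \<le> (\<integral>t. G M t / 2 - \<delta> M \<partial>lebesgue_on {0..T})"
        using KG [of M] by simp
      then have "ennreal (K * \<sigma> M / 2 - T * \<delta> M) \<le> ennreal (\<integral>t. G M t / 2 - \<delta> M \<partial>lebesgue_on {0..T})"
        by (rule ennreal_leI)
      also have "\<dots> \<le> (\<integral>\<^sup>+t. ennreal (G M t / 2 - \<delta> M) \<partial>lebesgue_on {0..T})"
        by (intro ennreal_integral_le_nn_integral Bochner_Integration.integrable_diff integrable_divide G_int const)
      also have "\<dots> \<le> X"
        unfolding X_def by (intro nn_integral_mono lower)
      finally show ?thesis .
    qed
    have "\<sigma> \<longlonglongrightarrow> E / (2 * pi)"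
      unfolding \<sigma>_def using filterlim_compose [OF sum0 [unfolded has_sum_def] filterlim_symmetric] .
    then have "(\<lambda>M. ennreal (K * \<sigma> M / 2 - T * \<delta> M)) \<longlonglongrightarrow> ennreal (K * (E / (2 * pi)) / 2 - T * (E - 2 * pi * (E / (2 * pi))))"
      unfolding \<delta>_def by (intro tendsto_intros tendsto_ennrealI) simp_all
    then have "ennreal (K * (E / (2 * pi)) / 2 - T * (E - 2 * pi * (E / (2 * pi)))) \<le> X"
      by (rule LIMSEQ_le_const2) (use bound in blast)
    then have X: "ennreal (K * E / (4 * pi)) \<le> X" by simp
    have E0: "E \<ge> 0" by (simp add: E_def energy_nonneg)
    have "(L2_norm_torus u0)\<^sup>2 = E"
      by (simp add: L2_norm_torus_def E_def energy_def)
    also have "E = C * (K * E / (4 * pi))" using K by (simp add: C_def)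
    also have "ennreal \<dots> = ennreal C * ennreal (K * E / (4 * pi))"
      using K E0 by (intro ennreal_mult) (auto simp: C_def)
    also have "\<dots> \<le> ennreal C * X" by (rule mult_left_mono [OF X]) simp
    finally show "ennreal ((L2_norm_torus u0)\<^sup>2) \<le> ennreal C *
      (\<integral>\<^sup>+t. (\<integral>\<^sup>+x. ennreal (b x * (cmod (schrodinger_flow \<alpha> t u0 x))\<^sup>2) \<partial>torus) \<partial>lebesgue_on {0..T})"
      unfolding X_def v_def .
  qed
qed

end
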